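(* Let $N\ge 2$ be an integer and let $f\in C(\mathbb{R},\mathbb{R})$ satisfy $\lim_{t\to 0} f(t)/t=0$. Let $F(t)=\int_0^t f(\tau)\,d\tau$, and for $m>0$ let $S_m$, $I$ and $E_m=\inf_{u\in S_m} I(u)$ be as defined in the context. Then $E_m>-\infty$ for every $m>0$, and the mapping $m\mapsto E_m$ is non-increasing and continuous on $(0,+\infty)$. Moreover: (i) There exists a uniquely determined number $m^*\in[0,+\infty]$ such that $E_m=0$ if $0<m\le m^*$ (for all $0<m<+\infty$ when $m^*=+\infty$), and $E_m<0$ if $m>m^*$. (ii) If in addition $F(t)/t^2$ is non-increasing on $(-\infty,0)$ and non-decreasing on $(0,+\infty)$, and $F(t)\le F(|t|)$ for all $t\in\mathbb{R}$, then for every $m>m^*$ (with $m<+\infty$) the infimum $E_m$ is achieved by some positive Schwarz symmetric function $u\in S_m$ (that is, $I(u)=E_m$, $u(x)>0$ for all $x\in\mathbb{Z}^N$, and $u$ is Schwarz symmetric). (iii) If in addition to the condition $\lim_{t\to0}f(t)/t=0$ there exists $\zeta>0$ such that $F(\zeta)-2N\zeta^2>0$, then $m^*\in[0,\zeta^2)$. (iv) If in addition to the condition $\lim_{t\to0}f(t)/t=0$ one has $\limsup_{t\to 0}\frac{F(t)}{|t|^{2+\frac4N}}<+\infty$, then $m^*\in(0,+\infty]$. (v) If in addition to the condition $\lim_{t\to0}f(t)/t=0$ the function $F(t)/t^2$ is strictly decreasing on $(-\infty,0)$ and strictly increasing on $(0,+\infty)$, then for every $0<m<m^*$ the infimum $E_m$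 is not achieved (there is no $u\in S_m$ with $I(u)=E_m$).
   Context: The lattice graph $\mathbb{Z}^N$ has vertex set $\{x=(x_1,\dots,x_N):x_i\in\mathbb{Z}\}$, and $x\sim y$ means $\sum_{i=1}^N|x_i-y_i|=1$. $\mu$ is the counting measure on $\mathbb{Z}^N$, so $\int_{\mathbb{Z}^N} g\,d\mu=\sum_{x\in\mathbb{Z}^N}g(x)$. $\ell^p(\mathbb{Z}^N)$ has its usual norm $\|\cdot\|_p$. For $u:\mathbb{Z}^N\to\mathbb{R}$, $$|\nabla u|(x)=\Big(\tfrac12\sum_{y\sim x}(u(y)-u(x))^2\Big)^{1/2}.$$ $H^1(\mathbb{Z}^N)$ is the completion of the finitely supported functions under the norm $\big(\tfrac12\sum_x\sum_{y\sim x}(u(y)-u(x))^2+\sum_x u(x)^2\big)^{1/2}$; it coincides with $\ell^2(\mathbb{Z}^N)$ with equivalent norms. For $m>0$, $S_m=\{u\in H^1(\mathbb{Z}^N):\|u\|_2^2=m\}$. The functional is $$I(u)=\frac12\int_{\mathbb{Z}^N}|\nabla u|^2\,d\mu-\int_{\mathbb{Z}^N}F(u)\,d\mu,\qquad u\in H^1(\mathbb{Z}^N),$$ and $E_m=\inf_{u\in S_m}I(u)$. Schwarz symmetry. Let $C_0^+(\mathbb{Z}^N)$ be the set of admissible functions, i.e. functions $u:\mathbb{Z}^N\to[0,\infty)$ such that $\{x:u(x)>t\}$ is finite for every $t>0$. Let $R=R_{\mathbb{Z}^N}:C_0^+(\mathbb{Z}^N)\to C_0^+(\mathbb{Z}^N)$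 denote the discrete Schwarz rearrangement operator on $\mathbb{Z}^N$ of Hajaiej, Han and Hua. A function $u\in C_0^+(\mathbb{Z}^N)$ is called Schwarz symmetric if $Ru=u$; $\mathcal{S}(\mathbb{Z}^N)$ denotes the set of Schwarz symmetric functions and $\mathcal{S}^p(\mathbb{Z}^N)=\mathcal{S}(\mathbb{Z}^N)\cap\ell^p(\mathbb{Z}^N)$. For the present purpose, $R$ is specified by the following known properties, which may be taken as given: (a) $R(Ru)=Ru$ for all $u\in C_0^+(\mathbb{Z}^N)$; (b) for every $g:[0,\infty)\to[0,\infty)$ with $g(0)=0$ and every $u\in C_0^+(\mathbb{Z}^N)$, $\sum_x g(u(x))=\sum_x g(Ru(x))$; (c) for every non-negative $u\in\ell^2(\mathbb{Z}^N)$, $\|\nabla (Ru)\|_2\le\|\nabla u\|_2$; (d) if $u_n\in\mathcal{S}(\mathbb{Z}^N)$ converge pointwise to $u\in C_0^+(\mathbb{Z}^N)$, then $u\in\mathcal{S}(\mathbb{Z}^N)$; (e) for $1\le p<q<\infty$, every bounded sequence in $\mathcal{S}^p(\mathbb{Z}^N)$ (bounded in $\ell^p$) has a subsequence converging in $\ell^q(\mathbb{Z}^N)$. *)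

theory Defs
  imports "HOL-Analysis.Analysis"
begin

section \<open>The lattice graph\<close>

text \<open>The lattice \<open>\<int>\<^sup>N\<close> is the type \<open>int ^ 'n\<close> with \<open>N = CARD('n)\<close>. Integrals with respect to the
  counting measure are unordered sums over \<open>UNIV\<close>.\<close>

definition adj :: "int ^ 'n \<Rightarrow> int ^ 'n \<Rightarrow> bool" where
  "adj x y \<longleftrightarrow> (\<Sum>i\<in>UNIV. \<bar>x $ i - y $ i\<bar>) = 1"

definition grad :: "(int ^ 'n \<Rightarrow> real) \<Rightarrow> int ^ 'n \<Rightarrow> real" where
  "grad u x = sqrt (1/2 * (\<Sum>y | adj x y. (u y - u x)\<^sup>2))"

definition lp :: "real \<Rightarrow> (int ^ 'n \<Rightarrow> real) set" where
  "lp p = {u. (\<lambda>x. \<bar>u x\<bar> powr p) summable_on UNIV}"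

definition lp_norm :: "real \<Rightarrow> (int ^ 'n \<Rightarrow> real) \<Rightarrow> real" where
  "lp_norm p u = (\<Sum>\<^sub>\<infinity>x. \<bar>u x\<bar> powr p) powr (1/p)"

definition H1_norm :: "(int ^ 'n \<Rightarrow> real) \<Rightarrow> real" where
  "H1_norm u = sqrt (1/2 * (\<Sum>\<^sub>\<infinity>x. \<Sum>y | adj x y. (u y - u x)\<^sup>2) + (\<Sum>\<^sub>\<infinity>x. (u x)\<^sup>2))"

text \<open>The completion of the finitely supported functions, realised as a space of functions: since
  \<open>H1_norm\<close> dominates \<open>\<bar>u x\<bar>\<close> for every \<open>x\<close>, a Cauchy sequence of finitely supported functions
  converges pointwise, and its class in the completion is identified with the pointwise limit.
  Lemma \<open>H1_eq_lp2\<close> below shows that the result is \<open>lp 2\<close>.\<close>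

definition H1 :: "(int ^ 'n \<Rightarrow> real) set" where
  "H1 = {u. \<exists>\<phi>. (\<forall>k. finite {x. \<phi> k x \<noteq> 0})
              \<and> (\<forall>e>0. \<exists>K. \<forall>j\<ge>K. \<forall>k\<ge>K. H1_norm (\<lambda>x. \<phi> j x - \<phi> k x) < e)
              \<and> (\<forall>x. (\<lambda>k::nat. \<phi> k x) \<longlonglongrightarrow> u x)}"

section \<open>The constrained minimisation problem\<close>

definition mass_sphere :: "real \<Rightarrow> (int ^ 'n \<Rightarrow> real) set" where
  "mass_sphere m = {u \<in> H1. (lp_norm 2 u)\<^sup>2 = m}"

definition energy :: "(real \<Rightarrow> real) \<Rightarrow> (int ^ 'n \<Rightarrow> real) \<Rightarrow> real" where
  "energy F u = 1/2 * (\<Sum>\<^sub>\<infinity>x. (grad u x)\<^sup>2) - (\<Sum>\<^sub>\<infinity>x. F (u x))"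

text \<open>The type argument fixes the dimension of the lattice. The infimum is taken in the extended
  reals, so that its finiteness is a genuine assertion.\<close>

definition ground_energy :: "'n::finite itself \<Rightarrow> (real \<Rightarrow> real) \<Rightarrow> real \<Rightarrow> ereal" where
  "ground_energy _ F m = (INF u \<in> (mass_sphere m :: (int ^ 'n \<Rightarrow> real) set). ereal (energy F u))"

definition is_threshold :: "'n::finite itself \<Rightarrow> (real \<Rightarrow> real) \<Rightarrow> ereal \<Rightarrow> bool" where
  "is_threshold N F ms \<longleftrightarrow> 0 \<le> ms
     \<and> (\<forall>m>0. ereal m \<le> ms \<longrightarrow> ground_energy N F m = 0)
     \<and> (\<forall>m>0. ms < ereal m \<longrightarrow> ground_energy N F m < 0)"

section \<open>Schwarz symmetry\<close>

definition admissible :: "(int ^ 'n \<Rightarrow> real) \<Rightarrow> bool" where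
  "admissible u \<longleftrightarrow> (\<forall>x. 0 \<le> u x) \<and> (\<forall>t>0. finite {x. u x > t})"

text \<open>For an operator \<open>R\<close> on functions, of which only the action on admissible functions is ever used.\<close>

definition schwarz_symmetric ::
  "((int ^ 'n \<Rightarrow> real) \<Rightarrow> int ^ 'n \<Rightarrow> real) \<Rightarrow> (int ^ 'n \<Rightarrow> real) \<Rightarrow> bool" where
  "schwarz_symmetric R u \<longleftrightarrow> admissible u \<and> R u = u"

text \<open>The properties specifying the discrete Schwarz rearrangement of Hajaiej, Han and Hua. The sums
  in \<open>equimeasurable\<close> may be infinite and are therefore taken in \<open>[0, \<infinity>]\<close>.\<close>

locale schwarz_rearrangement =
  fixes R :: "(int ^ 'n \<Rightarrow> real) \<Rightarrow> int ^ 'n \<Rightarrow> real"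
  assumes closed: "admissible u \<Longrightarrow> admissible (R u)"
    and idempotent: "admissible u \<Longrightarrow> R (R u) = R u"
    and equimeasurable: "\<lbrakk>\<forall>t\<ge>0. 0 \<le> g t; g 0 = 0; admissible u\<rbrakk> \<Longrightarrow>
      (\<Sum>\<^sub>\<infinity>x. ennreal (g (u x))) = (\<Sum>\<^sub>\<infinity>x. ennreal (g (R u x)))"
    and polya_szego: "\<lbrakk>u \<in> lp 2; \<forall>x. 0 \<le> u x\<rbrakk> \<Longrightarrow> lp_norm 2 (grad (R u)) \<le> lp_norm 2 (grad u)"
    and pointwise_closed: "\<lbrakk>\<forall>k::nat. schwarz_symmetric R (v k); admissible u;
      \<forall>x. (\<lambda>k. v k x) \<longlonglongrightarrow> u x\<rbrakk> \<Longrightarrow> schwarz_symmetric R u"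
    and compactness: "\<lbrakk>1 \<le> p; p < q; \<forall>k::nat. schwarz_symmetric R (v k) \<and> v k \<in> lp p;
      \<exists>C. \<forall>k. lp_norm p (v k) \<le> C\<rbrakk> \<Longrightarrow>
      \<exists>(s::nat \<Rightarrow> nat) w. strict_mono s \<and> w \<in> lp q \<and> (\<lambda>k. lp_norm q (\<lambda>x. v (s k) x - w x)) \<longlonglongrightarrow> 0"

section \<open>Identification of \<open>H1\<close> with \<open>lp 2\<close>\<close>

lemma adj_translate:
  fixes x :: "int ^ 'n"
  shows "{y. adj x y} = (+) x ` {e. adj 0 e}"
proof -
  have eq: "adj x y \<longleftrightarrow> adj 0 (y - x)" for y
    by (simp add: adj_def abs_minus_commute)
  show ?thesis
  proof (intro equalityI subsetI)
    fix y assume "y \<in> {y. adj x y}"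
    hence "y - x \<in> {e. adj 0 e}" using eq[of y] by simp
    thus "y \<in> (+) x ` {e. adj 0 e}" by (rule rev_image_eqI) simp
  next
    fix y assume "y \<in> (+) x ` {e. adj 0 e}"
    then obtain e where "adj 0 e" "y = x + e" by blast
    thus "y \<in> {y. adj x y}" using eq[of y] by simp
  qed
qed

lemma finite_adj:
  fixes x :: "int ^ 'n"
  shows "finite {y. adj x y}"
proof -
  have "{e :: int ^ 'n. adj 0 e} \<subseteq> vec_lambda ` (UNIV \<rightarrow>\<^sub>E {-1..1})"
  proof
    fix e :: "int ^ 'n" assume "e \<in> {e. adj 0 e}"
    hence s: "(\<Sum>i\<in>UNIV. \<bar>e $ i\<bar>) = 1" by (simp add: adj_def)
    have "\<bar>e $ i\<bar> \<le> 1" for i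
      using member_le_sum[of i UNIV "\<lambda>i. \<bar>e $ i\<bar>"] s by simp
    hence "(\<lambda>i. e $ i) \<in> UNIV \<rightarrow>\<^sub>E {-1..1}" by (simp add: PiE_iff abs_le_iff minus_le_iff)
    thus "e \<in> vec_lambda ` (UNIV \<rightarrow>\<^sub>E {-1..1})"
      by (intro image_eqI[where x = "\<lambda>i. e $ i"]) (simp_all add: vec_lambda_eta)
  qed
  hence "finite {e :: int ^ 'n. adj 0 e}"
    by (rule finite_subset) (intro finite_imageI finite_PiE, auto)
  thus ?thesis by (subst adj_translate) simp
qed

lemma sum_adj: "(\<Sum>y | adj x y. g y) = (\<Sum>e | adj 0 e. g (x + e))"
  by (subst adj_translate, subst sum.reindex) auto

lemma lp2_iff: "u \<in> lp 2 \<longleftrightarrow> (\<lambda>x. (u x)\<^sup>2) summable_on UNIV"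
  by (simp add: lp_def)

lemma H1_norm_ge:
  fixes v :: "int ^ 'n \<Rightarrow> real"
  assumes "finite {x. v x \<noteq> 0}" "finite A"
  shows "(\<Sum>x\<in>A. (v x)\<^sup>2) \<le> (H1_norm v)\<^sup>2"
proof -
  have "(\<lambda>x. (v x)\<^sup>2) summable_on UNIV"
    by (rule summable_on_cong_neutral[THEN iffD1, OF _ _ _ summable_on_finite[OF assms(1)]]) auto
  hence "(\<Sum>x\<in>A. (v x)\<^sup>2) \<le> (\<Sum>\<^sub>\<infinity>x. (v x)\<^sup>2)"
    by (rule finite_sum_le_infsum) (use assms in auto)
  moreover have "0 \<le> (\<Sum>\<^sub>\<infinity>x. \<Sum>y | adj x y. (v y - v x)\<^sup>2)"
    by (intro infsum_nonneg sum_nonneg) auto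
  moreover have "0 \<le> (\<Sum>\<^sub>\<infinity>x. (v x)\<^sup>2)" by (intro infsum_nonneg) auto
  ultimately show ?thesis by (simp add: H1_norm_def)
qed

lemma has_sum_finite_sum:
  fixes f :: "'a \<Rightarrow> 'b \<Rightarrow> real"
  assumes "\<And>e. ((\<lambda>x. f e x) has_sum s e) A"
  shows "((\<lambda>x. \<Sum>e\<in>D. f e x) has_sum (\<Sum>e\<in>D. s e)) A"
  by (induction D rule: infinite_finite_induct) (auto intro: has_sum_add assms)

lemma H1_norm_le:
  fixes v :: "int ^ 'n \<Rightarrow> real"
  assumes s: "(\<lambda>x. (v x)\<^sup>2) summable_on UNIV"
  shows "(H1_norm v)\<^sup>2 \<le> (2 * card {e :: int ^ 'n. adj 0 e} + 1) * (\<Sum>\<^sub>\<infinity>x. (v x)\<^sup>2)"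
proof -
  let ?D = "{e :: int ^ 'n. adj 0 e}" and ?S = "\<Sum>\<^sub>\<infinity>x. (v x)\<^sup>2"
  have bij: "bij (\<lambda>x. x + e)" for e :: "int ^ 'n"
    by (rule bij_betw_byWitness[where f' = "\<lambda>x. x - e"]) auto
  have sh: "((\<lambda>x. (v (x + e))\<^sup>2) has_sum ?S) UNIV" for e
    using summable_on_reindex_bij_betw[OF bij, of "\<lambda>x. (v x)\<^sup>2" e]
      infsum_reindex_bij_betw[OF bij, of "\<lambda>x. (v x)\<^sup>2" e] s by (simp add: has_sum_iff)
  have hs: "((\<lambda>x. \<Sum>e\<in>?D. 2 * (v (x + e))\<^sup>2 + 2 * (v x)\<^sup>2) has_sum (\<Sum>e\<in>?D. 2 * ?S + 2 * ?S)) UNIV"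
    by (intro has_sum_finite_sum has_sum_add has_sum_cmult_right sh[of 0, simplified] sh)
  have le: "(\<Sum>y | adj x y. (v y - v x)\<^sup>2) \<le> (\<Sum>e\<in>?D. 2 * (v (x + e))\<^sup>2 + 2 * (v x)\<^sup>2)" for x
  proof -
    have "(a - b)\<^sup>2 \<le> 2 * a\<^sup>2 + 2 * b\<^sup>2" for a b :: real
      using zero_le_power2[of "a + b"] by (simp add: power2_eq_square algebra_simps)
    thus ?thesis by (subst sum_adj) (intro sum_mono)
  qed
  have "(\<lambda>x. \<Sum>y | adj x y. (v y - v x)\<^sup>2) summable_on UNIV"
    by (rule summable_on_comparison_test[OF has_sum_imp_summable[OF hs]])
      (use le in \<open>auto intro: sum_nonneg\<close>)
  hence "(\<Sum>\<^sub>\<infinity>x. \<Sum>y | adj x y. (v y - v x)\<^sup>2) \<le> (\<Sum>e\<in>?D. 2 * ?S + 2 * ?S)"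
    using infsum_mono[OF _ has_sum_imp_summable[OF hs] le] infsumI[OF hs] by simp
  moreover have "0 \<le> (\<Sum>\<^sub>\<infinity>x. \<Sum>y | adj x y. (v y - v x)\<^sup>2)" "0 \<le> ?S"
    by (intro infsum_nonneg sum_nonneg, simp)+
  ultimately show ?thesis by (simp add: H1_norm_def algebra_simps)
qed

lemma H1_eq_lp2: "(H1 :: (int ^ 'n \<Rightarrow> real) set) = lp 2"
proof (intro set_eqI iffI)
  fix u :: "int ^ 'n \<Rightarrow> real" assume "u \<in> H1"
  then obtain \<phi> where fin: "\<And>k. finite {x. \<phi> k x \<noteq> 0}"
    and cau: "\<And>e. e > 0 \<Longrightarrow> \<exists>K. \<forall>j\<ge>K. \<forall>k\<ge>K. H1_norm (\<lambda>x. \<phi> j x - \<phi> k x) < e"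
    and lim: "\<And>x. (\<lambda>k::nat. \<phi> k x) \<longlonglongrightarrow> u x"
    unfolding H1_def by blast
  obtain K where K: "\<And>j. j \<ge> K \<Longrightarrow> H1_norm (\<lambda>x. \<phi> j x - \<phi> K x) < 1"
    using cau[of 1] by auto
  have bd: "(\<Sum>x\<in>A. (u x)\<^sup>2) \<le> 2 + 2 * (H1_norm (\<phi> K))\<^sup>2" if A: "finite A" for A
  proof -
    have "(\<Sum>x\<in>A. (\<phi> j x - \<phi> K x)\<^sup>2) \<le> 1" if "j \<ge> K" for j
    proof -
      have "finite {x. \<phi> j x - \<phi> K x \<noteq> 0}"
        by (rule finite_subset[OF _ finite_UnI[OF fin[of j] fin[of K]]]) auto
      from H1_norm_ge[OF this A] have "(\<Sum>x\<in>A. (\<phi> j x - \<phi> K x)\<^sup>2) \<le> (H1_norm (\<lambda>x. \<phi> j x - \<phi> K x))\<^sup>2" .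
      also have "\<dots> \<le> 1\<^sup>2"
        by (intro power_mono less_imp_le[OF K] that)
          (auto simp: H1_norm_def intro!: add_nonneg_nonneg mult_nonneg_nonneg infsum_nonneg sum_nonneg)
      finally show ?thesis by simp
    qed
    moreover have "(\<lambda>j. \<Sum>x\<in>A. (\<phi> j x - \<phi> K x)\<^sup>2) \<longlonglongrightarrow> (\<Sum>x\<in>A. (u x - \<phi> K x)\<^sup>2)"
      by (intro tendsto_intros lim)
    ultimately have 1: "(\<Sum>x\<in>A. (u x - \<phi> K x)\<^sup>2) \<le> 1"
      by (intro LIMSEQ_le_const2) auto
    have "(u x)\<^sup>2 \<le> 2 * (u x - \<phi> K x)\<^sup>2 + 2 * (\<phi> K x)\<^sup>2" for x
      using zero_le_power2[of "u x - 2 * \<phi> K x"] by (simp add: power2_eq_square algebra_simps)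
    hence "(\<Sum>x\<in>A. (u x)\<^sup>2) \<le> (\<Sum>x\<in>A. 2 * (u x - \<phi> K x)\<^sup>2 + 2 * (\<phi> K x)\<^sup>2)"
      by (intro sum_mono)
    also have "\<dots> = 2 * (\<Sum>x\<in>A. (u x - \<phi> K x)\<^sup>2) + 2 * (\<Sum>x\<in>A. (\<phi> K x)\<^sup>2)"
      by (simp add: sum.distrib sum_distrib_left)
    also have "\<dots> \<le> 2 + 2 * (H1_norm (\<phi> K))\<^sup>2"
      using 1 H1_norm_ge[OF fin A, of K] by simp
    finally show ?thesis .
  qed
  show "u \<in> lp 2" unfolding lp2_iff
    by (rule nonneg_bdd_above_summable_on) (use bd in \<open>auto intro!: bdd_aboveI2\<close>)
next
  fix u :: "int ^ 'n \<Rightarrow> real" assume "u \<in> lp 2"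
  hence s: "(\<lambda>x. (u x)\<^sup>2) summable_on UNIV" by (simp add: lp2_iff)
  define C where "C = 2 * real (card {e :: int ^ 'n. adj 0 e}) + 1"
  have "C > 0" by (simp add: C_def)
  let ?S = "\<Sum>\<^sub>\<infinity>x. (u x)\<^sup>2"
  have "\<exists>A. finite A \<and> ?S - (\<Sum>x\<in>A. (u x)\<^sup>2) < 1 / Suc k" for k
  proof -
    obtain A where "finite A" "dist (\<Sum>x\<in>A. (u x)\<^sup>2) ?S \<le> 1 / (2 * Suc k)"
      using infsum_finite_approximation[OF s, of "1 / (2 * Suc k)"] by auto
    moreover have "1 / (2 * Suc k) < 1 / real (Suc k)" by (simp add: field_simps)
    ultimately show ?thesis by (intro exI[of _ A]) (auto simp: dist_real_def)
  qed
  then obtain A where A: "\<And>k. finite (A k)" "\<And>k. ?S - (\<Sum>x\<in>A k. (u x)\<^sup>2) < 1 / Suc k"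
    by metis
  define \<phi> where "\<phi> k x = (if x \<in> A k then u x else 0)" for k x
  have fin: "finite {x. \<phi> k x \<noteq> 0}" for k
    by (rule finite_subset[OF _ A(1)[of k]]) (auto simp: \<phi>_def)
  have tail: "((\<lambda>x. (u x - \<phi> k x)\<^sup>2) has_sum (?S - (\<Sum>x\<in>A k. (u x)\<^sup>2))) UNIV" for k
  proof -
    have "((\<lambda>x. (\<phi> k x)\<^sup>2) has_sum (\<Sum>x\<in>A k. (u x)\<^sup>2)) UNIV"
      by (rule has_sum_cong_neutral[THEN iffD1, OF _ _ _ has_sum_finite[OF A(1)[of k]]])
        (auto simp: \<phi>_def)
    hence "((\<lambda>x. (u x)\<^sup>2 + - (\<phi> k x)\<^sup>2) has_sum (?S + - (\<Sum>x\<in>A k. (u x)\<^sup>2))) UNIV"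
      using s by (intro has_sum_add has_sum_uminusI) auto
    moreover have "(u x)\<^sup>2 + - (\<phi> k x)\<^sup>2 = (u x - \<phi> k x)\<^sup>2" for x by (simp add: \<phi>_def)
    ultimately show ?thesis by simp
  qed
  have lim: "(\<lambda>k. \<phi> k x) \<longlonglongrightarrow> u x" for x
  proof -
    have "(u x - \<phi> k x)\<^sup>2 \<le> 1 / Suc k" for k
      using finite_sum_le_has_sum[OF tail[of k], of "{x}"] A(2)[of k] by simp
    hence "(\<lambda>k. (u x - \<phi> k x)\<^sup>2) \<longlonglongrightarrow> 0"
      by (intro tendsto_sandwich[OF _ _ tendsto_const lim_1_over_n[THEN LIMSEQ_Suc]]) auto
    from tendsto_real_sqrt[OF this] have "(\<lambda>k. u x - \<phi> k x) \<longlonglongrightarrow> 0"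
      by (simp add: tendsto_rabs_zero_iff)
    from tendsto_diff[OF tendsto_const[of "u x"] this] show ?thesis by simp
  qed
  have cau: "\<exists>K. \<forall>j\<ge>K. \<forall>k\<ge>K. H1_norm (\<lambda>x. \<phi> j x - \<phi> k x) < e" if "e > 0" for e
  proof -
    have "e\<^sup>2 / (4 * C) > 0" using \<open>e > 0\<close> \<open>C > 0\<close> by simp
    then obtain K where K: "1 / Suc K < e\<^sup>2 / (4 * C)"
      using nat_approx_posE by blast
    have "H1_norm (\<lambda>x. \<phi> j x - \<phi> k x) < e" if jk: "j \<ge> K" "k \<ge> K" for j k
    proof -
      let ?T = "\<lambda>k. ?S - (\<Sum>x\<in>A k. (u x)\<^sup>2)"
      have T: "?T k < e\<^sup>2 / (4 * C)" if "k \<ge> K" for k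
      proof -
        have "1 / Suc k \<le> 1 / real (Suc K)" using that by (simp add: field_simps)
        thus ?thesis using A(2)[of k] K by simp
      qed
      have hs: "((\<lambda>x. 2 * (u x - \<phi> j x)\<^sup>2 + 2 * (u x - \<phi> k x)\<^sup>2) has_sum (2 * ?T j + 2 * ?T k)) UNIV"
        by (intro has_sum_add has_sum_cmult_right tail)
      have le: "(\<phi> j x - \<phi> k x)\<^sup>2 \<le> 2 * (u x - \<phi> j x)\<^sup>2 + 2 * (u x - \<phi> k x)\<^sup>2" for x
        using zero_le_power2[of "(u x - \<phi> j x) + (u x - \<phi> k x)"]
        by (simp add: power2_eq_square algebra_simps)
      have sm: "(\<lambda>x. (\<phi> j x - \<phi> k x)\<^sup>2) summable_on UNIV"
        by (rule summable_on_comparison_test[OF has_sum_imp_summable[OF hs]]) (use le in auto)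
      have "(\<Sum>\<^sub>\<infinity>x. (\<phi> j x - \<phi> k x)\<^sup>2) \<le> 2 * ?T j + 2 * ?T k"
        using infsum_mono[OF sm has_sum_imp_summable[OF hs] le] infsumI[OF hs] by simp
      also have "\<dots> < e\<^sup>2 / C" using T[OF jk(1)] T[OF jk(2)] by (simp add: field_simps)
      finally have "C * (\<Sum>\<^sub>\<infinity>x. (\<phi> j x - \<phi> k x)\<^sup>2) < e\<^sup>2"
        using \<open>C > 0\<close> by (simp add: field_simps)
      with H1_norm_le[OF sm] have "(H1_norm (\<lambda>x. \<phi> j x - \<phi> k x))\<^sup>2 < e\<^sup>2"
        by (simp add: C_def add.commute)
      thus ?thesis using \<open>e > 0\<close> by (simp add: power2_less_imp_less)
    qed
    thus ?thesis by blast
  qed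
  show "u \<in> H1" unfolding H1_def using fin cau lim by blast
qed

end

theory Submission
  imports Defs
begin

text \<open>Since \<open>F\<close> is locally Lipschitz relative to the quadratic scale, the energy is continuous on
  \<open>\<ell>\<^sup>2\<close>-bounded sets, so finitely supported functions suffice to compute \<open>E\<^sub>m\<close> and rescaling
  \<open>u\<close> makes \<open>E\<^sub>m\<close> locally Lipschitz in \<open>m\<close>. Indicators of large cubes show \<open>E\<^sub>m \<le> 0\<close>; placing
  two finitely supported functions far apart adds masses and energies, hence \<open>E\<^sub>m\<close> is
  non-increasing and vanishes exactly up to a threshold. The threshold is positive under the growth
  condition by the inequality \<open>\<parallel>u\<parallel>\<^sub>p\<^sup>p \<le> C \<parallel>u\<parallel>\<^sub>2\<^bsup>4/N\<^esup> \<parallel>\<nabla>u\<parallel>\<^sub>2\<^sup>2\<close> with \<open>p = 2 + 4/N\<close>. Above it, a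
  rearranged minimising sequence converges uniformly; its limit has energy at most \<open>E\<^sub>m < 0\<close>, and
  scaling the limit up to mass \<open>m\<close> would lower the energy below \<open>E\<^sub>m\<close> if mass had been lost.\<close>

section \<open>Geometry of the lattice\<close>

text \<open>On the lattice \<open>\<bar>u x\<bar>\<close> is at most the square root of the mass.
  For bounded mass only the values of \<open>F\<close> on a bounded interval enter, and one
  Lipschitz constant serves all competitors. The comparison of energies keeps a free weight
  \<delta>; each continuity statement is a choice of \<delta>. The obstacle is that the lattice has
  no dilations. Competitors are therefore changed in amplitude, moved by translations or modified at
  a single point. The inequality with exponent p cannot be obtained by scaling either: a
  Poincare-type bound for functions of small support is applied to dyadic slices of u, and p = 2 +
  4/N is the exponent for which the height of a slice cancels. In the existence part, monotonicity
  of \<open>F t / t\<^sup>2\<close> and its limit 0 at the origin give F \<ge> 0 on the half-line,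
  which the rearrangement of the potential term and the lower semicontinuity both use. Positivity of
  a minimiser comes from comparing orders: raising a zero to height \<epsilon> next to a positive
  value gains energy of order \<epsilon> but changes the mass only by \<epsilon> squared.\<close>

definition ell1 :: "int ^ 'n \<Rightarrow> int" where
  "ell1 h = (\<Sum>i\<in>UNIV. \<bar>h $ i\<bar>)"

lemma ell1_nonneg: "0 \<le> ell1 h"
  by (simp add: ell1_def sum_nonneg)

lemma ell1_eq_0_iff: "ell1 h = 0 \<longleftrightarrow> h = 0"
  by (simp add: ell1_def sum_nonneg_eq_0_iff vec_eq_iff)

lemma adj_0_iff: "adj 0 e \<longleftrightarrow> ell1 e = 1"
  by (simp add: adj_def ell1_def)

lemma adj_0_uminus: "adj 0 (- e) \<longleftrightarrow> adj 0 e"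
  by (simp add: adj_def)

lemma ell1_axis: "ell1 (axis i s :: int ^ 'n) = \<bar>s\<bar>"
proof -
  have "ell1 (axis i s :: int ^ 'n) = (\<Sum>j\<in>UNIV. if j = i then \<bar>s\<bar> else 0)"
    unfolding ell1_def by (intro sum.cong) (auto simp: axis_def)
  thus ?thesis by simp
qed

text \<open>Moving a nonzero coordinate one unit towards 0 shortens the vector. This is the
  induction step for arguments along lattice paths from 0 to \<open>h\<close>.\<close>

lemma ell1_step:
  fixes h :: "int ^ 'n"
  assumes "h \<noteq> 0"
  shows "\<exists>i s. s \<in> {1, -1} \<and> ell1 (h - axis i s) = ell1 h - 1"
proof -
  from assms obtain i where i: "h $ i \<noteq> 0" by (auto simp: vec_eq_iff)
  define s where "s = sgn (h $ i)"
  have "s \<in> {1, -1}" using i by (auto simp: s_def sgn_if)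
  moreover have "ell1 (h - axis i s) = (\<Sum>j\<in>UNIV. \<bar>h $ j\<bar> - (if j = i then 1 else 0))"
    unfolding ell1_def using i by (intro sum.cong refl) (auto simp: axis_def s_def sgn_if)
  hence "ell1 (h - axis i s) = ell1 h - 1"
    by (simp add: sum_subtractf ell1_def)
  ultimately show ?thesis by blast
qed

lemma card_adj_0_le: "card {e :: int ^ 'n. adj 0 e} \<le> 2 * CARD('n)"
proof -
  have "{e :: int ^ 'n. adj 0 e} \<subseteq> (\<lambda>(i, s). axis i s) ` (UNIV \<times> {1, -1})"
  proof
    fix e :: "int ^ 'n" assume "e \<in> {e. adj 0 e}"
    hence e: "ell1 e = 1" by (simp add: adj_0_iff)
    hence "e \<noteq> 0" using ell1_eq_0_iff[of e] by auto
    then obtain i s where s: "s \<in> {1, -1}" and "ell1 (e - axis i s) = ell1 e - 1"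
      using ell1_step by blast
    hence "e = axis i s" using e ell1_eq_0_iff[of "e - axis i s"] by simp
    with s show "e \<in> (\<lambda>(i, s). axis i s) ` (UNIV \<times> {1, -1})" by auto
  qed
  hence "card {e :: int ^ 'n. adj 0 e} \<le> card ((\<lambda>(i, s). axis i s :: int ^ 'n) ` (UNIV \<times> {1, -1}))"
    by (rule card_mono[rotated]) auto
  also have "\<dots> \<le> card ((UNIV :: 'n set) \<times> {1, -1 :: int})" by (rule card_image_le) auto
  also have "\<dots> = 2 * CARD('n)" by (simp add: card_cartesian_product)
  finally show ?thesis .
qed

lemma
  fixes S :: "int set"
  assumes "finite S"
  shows finite_box: "finite {x :: int ^ 'n. \<forall>i. x $ i \<in> S}"
    and card_box: "card {x :: int ^ 'n. \<forall>i. x $ i \<in> S} = card S ^ CARD('n)"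
proof -
  have "bij_betw (vec_lambda :: ('n \<Rightarrow> int) \<Rightarrow> _) (UNIV \<rightarrow>\<^sub>E S) {x. \<forall>i. x $ i \<in> S}"
    by (rule bij_betw_byWitness[where f' = vec_nth]) (auto simp: PiE_iff)
  moreover have "finite (UNIV \<rightarrow>\<^sub>E S :: ('n \<Rightarrow> int) set)" using assms by (intro finite_PiE) auto
  moreover have "card (UNIV \<rightarrow>\<^sub>E S :: ('n \<Rightarrow> int) set) = card S ^ CARD('n)"
    by (simp add: card_PiE)
  ultimately show "finite {x :: int ^ 'n. \<forall>i. x $ i \<in> S}"
    and "card {x :: int ^ 'n. \<forall>i. x $ i \<in> S} = card S ^ CARD('n)"
    using bij_betw_finite bij_betw_same_card by metis+
qed

section \<open>Square-summable functions\<close>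

definition mass :: "(int ^ 'n \<Rightarrow> real) \<Rightarrow> real" where
  "mass u = (\<Sum>\<^sub>\<infinity>x. (u x)\<^sup>2)"

definition increment :: "int ^ 'n \<Rightarrow> (int ^ 'n \<Rightarrow> real) \<Rightarrow> int ^ 'n \<Rightarrow> real" where
  "increment e u x = u (x + e) - u x"

text \<open>Every edge is counted twice, once for \<open>e\<close> and once for \<open>-e\<close>;
  hence the factor 1/2 in \<open>has_sum_grad\<close> and 1/4 in \<open>energy_eq\<close>. As a
  finite sum of masses it inherits estimates from the square-summable setting, direction by
  direction.\<close>

definition dirichlet :: "(int ^ 'n \<Rightarrow> real) \<Rightarrow> real" where
  "dirichlet u = (\<Sum>e | adj 0 e. mass (increment e u))"

lemma square_sum_le: "(a + b)\<^sup>2 \<le> 2 * a\<^sup>2 + 2 * b\<^sup>2" for a b :: real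
  using zero_le_power2[of "a - b"] by (simp add: power2_eq_square algebra_simps)

lemma square_diff_le: "(a - b)\<^sup>2 \<le> 2 * a\<^sup>2 + 2 * b\<^sup>2" for a b :: real
  using square_sum_le[of a "-b"] by simp

lemma lp2_has_sum: "u \<in> lp 2 \<Longrightarrow> ((\<lambda>x. (u x)\<^sup>2) has_sum mass u) UNIV"
  by (simp add: lp2_iff mass_def)

lemma lp2_finite_support: "finite {x. u x \<noteq> 0} \<Longrightarrow> u \<in> lp 2"
  unfolding lp2_iff
  by (rule summable_on_cong_neutral[THEN iffD1, OF _ _ _ summable_on_finite]) auto

lemma lp2_mono: "v \<in> lp 2 \<Longrightarrow> (\<And>x. \<bar>u x\<bar> \<le> \<bar>v x\<bar>) \<Longrightarrow> u \<in> lp 2"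
  unfolding lp2_iff by (rule summable_on_comparison_test) (auto simp: abs_le_square_iff)

lemma mass_mono: "v \<in> lp 2 \<Longrightarrow> (\<And>x. \<bar>u x\<bar> \<le> \<bar>v x\<bar>) \<Longrightarrow> mass u \<le> mass v"
  unfolding mass_def using lp2_mono[of v u]
  by (intro infsum_mono) (auto simp: lp2_iff abs_le_square_iff)

lemma mass_nonneg: "0 \<le> mass u"
  by (simp add: mass_def infsum_nonneg)

lemma sum_le_mass: "u \<in> lp 2 \<Longrightarrow> finite A \<Longrightarrow> (\<Sum>x\<in>A. (u x)\<^sup>2) \<le> mass u"
  unfolding mass_def lp2_iff by (intro finite_sum_le_infsum) auto

lemma square_le_mass: "u \<in> lp 2 \<Longrightarrow> (u x)\<^sup>2 \<le> mass u"
  using sum_le_mass[of u "{x}"] by simp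

lemma abs_le_sqrt_mass: "u \<in> lp 2 \<Longrightarrow> mass u \<le> m \<Longrightarrow> \<bar>u x\<bar> \<le> sqrt m"
  using square_le_mass[of u x] by (intro real_le_rsqrt) simp

lemma mass_eq_0_iff: "u \<in> lp 2 \<Longrightarrow> mass u = 0 \<longleftrightarrow> u = (\<lambda>_. 0)"
  using square_le_mass[of u] by (auto simp: mass_def fun_eq_iff)

lemma mass_finite_support: "finite A \<Longrightarrow> (\<And>x. x \<notin> A \<Longrightarrow> u x = 0) \<Longrightarrow> mass u = (\<Sum>x\<in>A. (u x)\<^sup>2)"
  unfolding mass_def
  by (subst infsum_finite[symmetric], assumption) (rule infsum_cong_neutral, auto)

lemma lp2_cmult:
  assumes "u \<in> lp 2"
  shows "(\<lambda>x. c * u x) \<in> lp 2" and "mass (\<lambda>x. c * u x) = c\<^sup>2 * mass u"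
  using assms by (simp_all add: lp2_iff mass_def power_mult_distrib summable_on_cmult_right infsum_cmult_right)

lemma lp2_add:
  assumes "u \<in> lp 2" "v \<in> lp 2"
  shows "(\<lambda>x. u x + v x) \<in> lp 2" and "mass (\<lambda>x. u x + v x) \<le> 2 * mass u + 2 * mass v"
proof -
  have hs: "((\<lambda>x. 2 * (u x)\<^sup>2 + 2 * (v x)\<^sup>2) has_sum (2 * mass u + 2 * mass v)) UNIV"
    using assms by (intro has_sum_add has_sum_cmult_right lp2_has_sum)
  show "(\<lambda>x. u x + v x) \<in> lp 2" unfolding lp2_iff
    by (rule summable_on_comparison_test[OF has_sum_imp_summable[OF hs]]) (auto simp: square_sum_le)
  thus "mass (\<lambda>x. u x + v x) \<le> 2 * mass u + 2 * mass v"
    unfolding mass_def[of "\<lambda>x. u x + v x"] lp2_iff infsumI[OF hs, symmetric]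
    by (intro infsum_mono has_sum_imp_summable[OF hs]) (auto simp: square_sum_le)
qed

lemma lp2_diff:
  assumes "u \<in> lp 2" "v \<in> lp 2"
  shows "(\<lambda>x. u x - v x) \<in> lp 2" and "mass (\<lambda>x. u x - v x) \<le> 2 * mass u + 2 * mass v"
  using lp2_add[OF assms(1) lp2_cmult(1)[OF assms(2), of "-1"]] lp2_cmult(2)[OF assms(2), of "-1"]
  by simp_all

lemma
  fixes g :: "int ^ 'n \<Rightarrow> 'a :: {topological_comm_monoid_add, t2_space}"
  shows summable_on_translate: "(\<lambda>x. g (x + e)) summable_on UNIV \<longleftrightarrow> g summable_on UNIV"
    and infsum_translate: "(\<Sum>\<^sub>\<infinity>x. g (x + e)) = (\<Sum>\<^sub>\<infinity>x. g x)"
proof -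
  have bij: "bij (\<lambda>x. x + e)"
    by (rule bij_betw_byWitness[where f' = "\<lambda>x. x - e"]) auto
  show "(\<lambda>x. g (x + e)) summable_on UNIV \<longleftrightarrow> g summable_on UNIV"
    by (rule summable_on_reindex_bij_betw[OF bij])
  show "(\<Sum>\<^sub>\<infinity>x. g (x + e)) = (\<Sum>\<^sub>\<infinity>x. g x)"
    by (rule infsum_reindex_bij_betw[OF bij])
qed

lemma lp2_translate: "(\<lambda>x. u (x + e)) \<in> lp 2 \<longleftrightarrow> u \<in> lp 2"
  unfolding lp2_iff by (rule summable_on_translate)

lemma mass_translate: "mass (\<lambda>x. u (x + e)) = mass u"
  unfolding mass_def by (rule infsum_translate)

lemma lp2_increment: "u \<in> lp 2 \<Longrightarrow> increment e u \<in> lp 2"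
  unfolding increment_def by (intro lp2_diff lp2_translate[THEN iffD2])

lemma mass_increment_le: "u \<in> lp 2 \<Longrightarrow> mass (increment e u) \<le> 4 * mass u"
  using lp2_diff(2)[of "\<lambda>x. u (x + e)" u] unfolding increment_def
  by (simp add: lp2_translate mass_translate)

lemma dirichlet_nonneg: "0 \<le> dirichlet u"
  by (simp add: dirichlet_def sum_nonneg mass_nonneg)

lemma mass_increment_le_dirichlet: "adj 0 e \<Longrightarrow> mass (increment e u) \<le> dirichlet u"
  unfolding dirichlet_def by (rule member_le_sum) (auto simp: mass_nonneg finite_adj)

lemma dirichlet_le: "u \<in> lp 2 \<Longrightarrow> dirichlet u \<le> 4 * real (card {e :: int ^ 'n. adj 0 e}) * mass (u :: int ^ 'n \<Rightarrow> real)"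
  using sum_bounded_above[of "{e :: int ^ 'n. adj 0 e}" "\<lambda>e. mass (increment e u)" "4 * mass u"]
  by (simp add: dirichlet_def mass_increment_le)

lemma dirichlet_cmult: "u \<in> lp 2 \<Longrightarrow> dirichlet (\<lambda>x. c * u x) = c\<^sup>2 * dirichlet u"
proof -
  assume "u \<in> lp 2"
  have "increment e (\<lambda>x. c * u x) = (\<lambda>x. c * increment e u x)" for e
    by (simp add: increment_def fun_eq_iff algebra_simps)
  thus ?thesis
    by (simp add: dirichlet_def lp2_cmult(2) lp2_increment \<open>u \<in> lp 2\<close> sum_distrib_left)
qed

lemma dirichlet_translate: "dirichlet (\<lambda>x. u (x + h)) = dirichlet u"
proof -
  have "increment e (\<lambda>x. u (x + h)) = (\<lambda>x. increment e u (x + h))" for e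
    by (simp add: increment_def fun_eq_iff algebra_simps)
  thus ?thesis by (simp add: dirichlet_def mass_translate)
qed

lemma dirichlet_contract:
  assumes "u \<in> lp 2" "\<And>x y. \<bar>v x - v y\<bar> \<le> \<bar>u x - u y\<bar>"
  shows "dirichlet v \<le> dirichlet u"
  unfolding dirichlet_def using assms
  by (intro sum_mono mass_mono lp2_increment) (auto simp: increment_def)

lemma has_sum_grad:
  assumes "u \<in> lp 2"
  shows "((\<lambda>x. (grad u x)\<^sup>2) has_sum (1/2 * dirichlet u)) UNIV"
proof -
  have eq: "(grad u x)\<^sup>2 = 1/2 * (\<Sum>e | adj 0 e. (increment e u x)\<^sup>2)" for x
    by (simp add: grad_def increment_def sum_adj[where x = x] sum_nonneg)
  show ?thesis unfolding eq dirichlet_def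
    by (intro has_sum_cmult_right has_sum_finite_sum[OF lp2_has_sum] lp2_increment assms)
qed

lemma energy_eq: "u \<in> lp 2 \<Longrightarrow> energy F u = 1/4 * dirichlet u - (\<Sum>\<^sub>\<infinity>x. F (u x))"
  using infsumI[OF has_sum_grad, of u] by (simp add: energy_def)

lemma mass_sphere_iff: "u \<in> mass_sphere m \<longleftrightarrow> u \<in> lp 2 \<and> mass u = m"
proof -
  have "(lp_norm 2 u)\<^sup>2 = mass u"
    using mass_nonneg[of u] by (simp add: lp_norm_def mass_def powr_half_sqrt infsum_nonneg)
  thus ?thesis by (auto simp: mass_sphere_def H1_eq_lp2)
qed


section \<open>Continuity of the energy\<close>

lemma has_sum_abs_le:
  fixes f g :: "'a \<Rightarrow> real"
  assumes "(f has_sum a) A" "(g has_sum b) A" "\<And>x. x \<in> A \<Longrightarrow> \<bar>f x\<bar> \<le> g x"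
  shows "\<bar>a\<bar> \<le> b"
proof -
  have "a \<le> b" by (rule has_sum_mono[OF assms(1,2)]) (use assms(3) in force)
  moreover have "- b \<le> a"
    by (rule has_sum_mono[OF has_sum_uminusI[OF assms(2)] assms(1)]) (use assms(3) in force)
  ultimately show ?thesis by linarith
qed

text \<open>Young's inequality with a free weight. It takes the place of Cauchy-Schwarz below, since
  it can be summed termwise.\<close>

lemma mult_le_weighted_squares:
  fixes a b \<delta> :: real
  assumes "\<delta> > 0"
  shows "(\<bar>a\<bar> + \<bar>b\<bar>) * \<bar>a - b\<bar> \<le> \<delta> * (a\<^sup>2 + b\<^sup>2) + (a - b)\<^sup>2 / \<delta>"
proof -
  let ?s = "\<bar>a\<bar> + \<bar>b\<bar>" and ?t = "\<bar>a - b\<bar>"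
  have "0 \<le> (\<delta> * ?s - ?t)\<^sup>2 / (2 * \<delta>)" using assms by simp
  also have "\<dots> = \<delta> / 2 * ?s\<^sup>2 - ?s * ?t + ?t\<^sup>2 / (2 * \<delta>)"
    using assms by (simp add: field_simps power2_eq_square)
  finally have "?s * ?t \<le> \<delta> / 2 * ?s\<^sup>2 + ?t\<^sup>2 / (2 * \<delta>)" by simp
  also have "\<delta> / 2 * ?s\<^sup>2 \<le> \<delta> / 2 * (2 * \<bar>a\<bar>\<^sup>2 + 2 * \<bar>b\<bar>\<^sup>2)"
    using assms by (intro mult_left_mono square_sum_le) auto
  also have "?t\<^sup>2 / (2 * \<delta>) \<le> ?t\<^sup>2 / \<delta>" using assms by (simp add: field_simps)
  finally show ?thesis by (simp add: algebra_simps)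
qed

lemma abs_mass_diff_le:
  assumes "p \<in> lp 2" "q \<in> lp 2" "\<delta> > 0"
  shows "\<bar>mass p - mass q\<bar> \<le> \<delta> * (mass p + mass q) + mass (\<lambda>x. p x - q x) / \<delta>"
proof (rule has_sum_abs_le)
  show "((\<lambda>x. (p x)\<^sup>2 + - (q x)\<^sup>2) has_sum mass p - mass q) UNIV"
    using has_sum_add[OF lp2_has_sum[OF assms(1)] has_sum_uminusI[OF lp2_has_sum[OF assms(2)]]] by simp
  show "((\<lambda>x. \<delta> * ((p x)\<^sup>2 + (q x)\<^sup>2) + (p x - q x)\<^sup>2 * (1 / \<delta>)) has_sum
      \<delta> * (mass p + mass q) + mass (\<lambda>x. p x - q x) / \<delta>) UNIV"
    using assms unfolding divide_inverse mult_1
    by (intro has_sum_add has_sum_cmult_right has_sum_cmult_left lp2_has_sum lp2_diff(1))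
  fix x
  have "\<bar>(p x)\<^sup>2 - (q x)\<^sup>2\<bar> = \<bar>p x + q x\<bar> * \<bar>p x - q x\<bar>"
    by (simp add: power2_eq_square abs_mult[symmetric] algebra_simps)
  also have "\<dots> \<le> (\<bar>p x\<bar> + \<bar>q x\<bar>) * \<bar>p x - q x\<bar>"
    by (intro mult_right_mono) auto
  also have "\<dots> \<le> \<delta> * ((p x)\<^sup>2 + (q x)\<^sup>2) + (p x - q x)\<^sup>2 / \<delta>"
    by (rule mult_le_weighted_squares) fact
  finally show "\<bar>(p x)\<^sup>2 + - (q x)\<^sup>2\<bar> \<le> \<delta> * ((p x)\<^sup>2 + (q x)\<^sup>2) + (p x - q x)\<^sup>2 * (1 / \<delta>)"
    by simp
qed

lemma abs_dirichlet_diff_le: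
  fixes u v :: "int ^ 'n \<Rightarrow> real"
  assumes u: "u \<in> lp 2" and v: "v \<in> lp 2" and "\<delta> > 0"
  shows "\<bar>dirichlet u - dirichlet v\<bar>
    \<le> 4 * real (card {e :: int ^ 'n. adj 0 e}) * (\<delta> * (mass u + mass v) + mass (\<lambda>x. u x - v x) / \<delta>)"
proof -
  let ?B = "\<delta> * (mass u + mass v) + mass (\<lambda>x. u x - v x) / \<delta>"
  have "\<bar>mass (increment e u) - mass (increment e v)\<bar> \<le> 4 * ?B" for e
  proof -
    have eq: "(\<lambda>x. increment e u x - increment e v x) = increment e (\<lambda>x. u x - v x)"
      by (simp add: increment_def fun_eq_iff)
    have "\<bar>mass (increment e u) - mass (increment e v)\<bar>
        \<le> \<delta> * (mass (increment e u) + mass (increment e v)) + mass (increment e (\<lambda>x. u x - v x)) / \<delta>"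
      using abs_mass_diff_le[OF lp2_increment[OF u, of e] lp2_increment[OF v, of e] \<open>\<delta> > 0\<close>]
      by (simp add: eq)
    also have "\<dots> \<le> \<delta> * (4 * mass u + 4 * mass v) + 4 * mass (\<lambda>x. u x - v x) / \<delta>"
      using assms by (intro add_mono mult_left_mono divide_right_mono mass_increment_le lp2_diff(1)) auto
    finally show ?thesis by (simp add: algebra_simps)
  qed
  hence "\<bar>\<Sum>e | adj 0 e. mass (increment e u) - mass (increment e v)\<bar>
      \<le> (\<Sum>e :: int ^ 'n | adj 0 e. 4 * ?B)"
    by (intro order_trans[OF sum_abs] sum_mono)
  also have "\<dots> = 4 * real (card {e :: int ^ 'n. adj 0 e}) * ?B" by simp
  finally show ?thesis by (simp only: dirichlet_def sum_subtractf)
qed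

text \<open>The variational argument uses \<open>f\<close> only through these properties of its primitive.\<close>

locale potential =
  fixes F :: "real \<Rightarrow> real"
  assumes F_0: "F 0 = 0"
    and F_lipschitz: "\<exists>C\<ge>0. \<forall>a b. \<bar>a\<bar> \<le> M \<longrightarrow> \<bar>b\<bar> \<le> M \<longrightarrow> \<bar>F a - F b\<bar> \<le> C * ((\<bar>a\<bar> + \<bar>b\<bar>) * \<bar>a - b\<bar>)"
    and F_small: "\<eta> > 0 \<Longrightarrow> \<exists>\<rho>>0. \<forall>t. \<bar>t\<bar> \<le> \<rho> \<longrightarrow> \<bar>F t\<bar> \<le> \<eta> * t\<^sup>2"
begin

lemma F_quadratic: "\<exists>C\<ge>0. \<forall>a. \<bar>a\<bar> \<le> M \<longrightarrow> \<bar>F a\<bar> \<le> C * a\<^sup>2"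
proof -
  obtain C where C: "C \<ge> 0" "\<And>a b. \<bar>a\<bar> \<le> M \<Longrightarrow> \<bar>b\<bar> \<le> M \<Longrightarrow> \<bar>F a - F b\<bar> \<le> C * ((\<bar>a\<bar> + \<bar>b\<bar>) * \<bar>a - b\<bar>)"
    using F_lipschitz[of M] by blast
  have "\<bar>F a\<bar> \<le> C * a\<^sup>2" if "\<bar>a\<bar> \<le> M" for a
    using C(2)[OF that, of 0] that by (simp add: F_0 power2_eq_square abs_mult[symmetric])
  with C(1) show ?thesis by blast
qed

lemma F_summable:
  assumes "u \<in> lp 2"
  shows "(\<lambda>x. F (u x)) summable_on UNIV"
proof -
  obtain C where C: "\<And>a. \<bar>a\<bar> \<le> sqrt (mass u) \<Longrightarrow> \<bar>F a\<bar> \<le> C * a\<^sup>2"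
    using F_quadratic by blast
  have "(\<lambda>x. C * (u x)\<^sup>2) summable_on UNIV"
    using assms by (intro summable_on_cmult_right) (simp add: lp2_iff)
  hence "(\<lambda>x. \<bar>F (u x)\<bar>) summable_on UNIV"
    by (rule summable_on_comparison_test) (use C abs_le_sqrt_mass[OF assms order_refl] in auto)
  thus ?thesis by (subst summable_on_iff_abs_summable_on_real) simp
qed

lemma F_has_sum: "u \<in> lp 2 \<Longrightarrow> ((\<lambda>x. F (u x)) has_sum (\<Sum>\<^sub>\<infinity>x. F (u x))) UNIV"
  by (rule has_sum_infsum[OF F_summable])

lemma energy_ge:
  "\<exists>C\<ge>0. \<forall>u \<in> (lp 2 :: (int ^ 'n \<Rightarrow> real) set). mass u \<le> m \<longrightarrow> - C * mass u \<le> energy F u"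
proof -
  obtain C where C: "C \<ge> 0" "\<And>a. \<bar>a\<bar> \<le> sqrt m \<Longrightarrow> \<bar>F a\<bar> \<le> C * a\<^sup>2"
    using F_quadratic by blast
  have "- C * mass u \<le> energy F u" if "u \<in> lp 2" "mass u \<le> m" for u :: "int ^ 'n \<Rightarrow> real"
  proof -
    have "\<bar>\<Sum>\<^sub>\<infinity>x. F (u x)\<bar> \<le> C * mass u"
      by (rule has_sum_abs_le[OF F_has_sum has_sum_cmult_right[OF lp2_has_sum]])
        (use that C(2) abs_le_sqrt_mass[OF that] in auto)
    thus ?thesis using dirichlet_nonneg[of u] energy_eq[OF that(1), of F] by simp
  qed
  with C(1) show ?thesis by blast
qed

text \<open>The constant depends on the mass bound only, and \<delta> stays free: a fixed small
  \<delta> serves for approximation, while a \<delta> proportional to the distance of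
  \<open>u\<close> and \<open>v\<close> gives a Lipschitz estimate.\<close>

lemma energy_diff:
  "\<exists>K>0. \<forall>u \<in> (lp 2 :: (int ^ 'n \<Rightarrow> real) set). \<forall>v \<in> lp 2. \<forall>\<delta>>0. mass u \<le> m \<longrightarrow> mass v \<le> m \<longrightarrow>
    \<bar>energy F u - energy F v\<bar> \<le> K * (\<delta> * (mass u + mass v) + mass (\<lambda>x. u x - v x) / \<delta>)"
proof -
  obtain C where C: "C \<ge> 0"
    "\<And>a b. \<bar>a\<bar> \<le> sqrt m \<Longrightarrow> \<bar>b\<bar> \<le> sqrt m \<Longrightarrow> \<bar>F a - F b\<bar> \<le> C * ((\<bar>a\<bar> + \<bar>b\<bar>) * \<bar>a - b\<bar>)"
    using F_lipschitz by blast
  define c where "c = real (card {e :: int ^ 'n. adj 0 e})"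
  have "\<bar>energy F u - energy F v\<bar> \<le> (c + C + 1) * (\<delta> * (mass u + mass v) + mass (\<lambda>x. u x - v x) / \<delta>)"
    if u: "u \<in> lp 2" and v: "v \<in> lp 2" and "\<delta> > 0" and m: "mass u \<le> m" "mass v \<le> m"
    for u v :: "int ^ 'n \<Rightarrow> real" and \<delta> :: real
  proof -
    let ?B = "\<delta> * (mass u + mass v) + mass (\<lambda>x. u x - v x) / \<delta>"
    have "0 \<le> ?B" using \<open>\<delta> > 0\<close> by (simp add: mass_nonneg)
    have "\<bar>(\<Sum>\<^sub>\<infinity>x. F (u x)) + - (\<Sum>\<^sub>\<infinity>x. F (v x))\<bar> \<le> C * ?B"
    proof (rule has_sum_abs_le)
      show "((\<lambda>x. F (u x) + - F (v x)) has_sum (\<Sum>\<^sub>\<infinity>x. F (u x)) + - (\<Sum>\<^sub>\<infinity>x. F (v x))) UNIV"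
        by (intro has_sum_add has_sum_uminusI F_has_sum u v)
      show "((\<lambda>x. C * (\<delta> * ((u x)\<^sup>2 + (v x)\<^sup>2) + (u x - v x)\<^sup>2 * inverse \<delta>)) has_sum C * ?B) UNIV"
        using u v unfolding divide_inverse
        by (intro has_sum_add has_sum_cmult_right has_sum_cmult_left lp2_has_sum lp2_diff(1))
      fix x
      show "\<bar>F (u x) + - F (v x)\<bar> \<le> C * (\<delta> * ((u x)\<^sup>2 + (v x)\<^sup>2) + (u x - v x)\<^sup>2 * inverse \<delta>)"
        using C(2)[OF abs_le_sqrt_mass[OF u m(1), of x] abs_le_sqrt_mass[OF v m(2), of x]]
          mult_left_mono[OF mult_le_weighted_squares[OF \<open>\<delta> > 0\<close>, of "u x" "v x"] C(1)]
        by (simp add: divide_inverse)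
    qed
    moreover have "\<bar>dirichlet u - dirichlet v\<bar> \<le> 4 * c * ?B"
      unfolding c_def by (rule abs_dirichlet_diff_le[OF u v \<open>\<delta> > 0\<close>])
    ultimately have "\<bar>energy F u - energy F v\<bar> \<le> c * ?B + C * ?B"
      unfolding energy_eq[OF u] energy_eq[OF v] by (simp add: abs_le_iff)
    with \<open>0 \<le> ?B\<close> show ?thesis by (simp only: distrib_right mult_1)
  qed
  moreover have "c + C + 1 > 0" using C(1) by (simp add: c_def)
  ultimately show ?thesis by blast
qed

text \<open>Cutting \<open>u\<close> off outside a large finite set loses a little mass, which a
  factor \<open>t\<close> \<ge> 1 restores. Both changes are small in mass, so
  \<open>energy_diff\<close> applies.\<close>

lemma finite_support_approximation:
  fixes u :: "int ^ 'n \<Rightarrow> real"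
  assumes u: "u \<in> lp 2" and m: "mass u = m" "m > 0" and "\<epsilon> > 0"
  shows "\<exists>v :: int ^ 'n \<Rightarrow> real. finite {x. v x \<noteq> 0} \<and> mass v = m \<and> energy F v < energy F u + \<epsilon>"
proof -
  obtain K where K: "K > 0" "\<And>v \<delta>. v \<in> lp 2 \<Longrightarrow> \<delta> > 0 \<Longrightarrow> mass v \<le> m \<Longrightarrow>
      \<bar>energy F u - energy F v\<bar> \<le> K * (\<delta> * (mass u + mass v) + mass (\<lambda>x. u x - v x) / \<delta>)"
    using energy_diff[where m = m and 'n = 'n] u m(1) by blast
  \<comment> \<open>The two terms of the bound are to be at most \<open>\<epsilon> / (4 * K)\<close>
    each: this fixes \<delta>, since both masses equal \<open>m\<close>, and then \<theta>, since
    the distance will be at most \<open>4 * \<theta>\<close>. The bound \<open>m / 2\<close> keeps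
    the mass of the cut-off positive.\<close>
  define \<delta> where "\<delta> = \<epsilon> / (8 * K * m)"
  define \<theta> where "\<theta> = min (m / 2) (\<epsilon> * \<delta> / (16 * K))"
  have "\<delta> > 0" "\<theta> > 0" using assms K by (auto simp: \<delta>_def \<theta>_def)
  obtain A where A: "finite A" and approx: "dist (\<Sum>x\<in>A. (u x)\<^sup>2) m \<le> \<theta>"
    using infsum_finite_approximation[of "\<lambda>x. (u x)\<^sup>2" UNIV \<theta>] u \<open>\<theta> > 0\<close> m(1)
    by (auto simp: lp2_iff mass_def)
  define w where "w = (\<lambda>x. if x \<in> A then u x else 0)"
  define a where "a = mass w"
  define t where "t = sqrt (m / a)"
  define v where "v = (\<lambda>x. t * w x)"
  have a_sum: "a = (\<Sum>x\<in>A. (u x)\<^sup>2)"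
    unfolding a_def by (subst mass_finite_support[OF A]) (auto simp: w_def)
  have "a \<le> m" using sum_le_mass[OF u A] m by (simp add: a_sum)
  have a_ge: "m - a \<le> \<theta>" using approx by (simp add: a_sum dist_real_def)
  have "\<theta> \<le> m / 2" by (simp add: \<theta>_def)
  hence "a > 0" using m(2) a_ge by linarith
  have w: "w \<in> lp 2" by (rule lp2_mono[OF u]) (simp add: w_def)
  have v: "v \<in> lp 2" "mass v = m"
    using lp2_cmult[OF w, of t] \<open>a > 0\<close> m(2) by (simp_all add: v_def t_def a_def)
  have "finite {x. v x \<noteq> 0}"
    by (rule finite_subset[OF _ A]) (auto simp: v_def w_def)
  have uw: "mass (\<lambda>x. u x - w x) = m - a"
  proof -
    have "((\<lambda>x. (u x)\<^sup>2 + - (w x)\<^sup>2) has_sum (m + - a)) UNIV"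
      using lp2_has_sum[OF u] lp2_has_sum[OF w] m unfolding a_def
      by (intro has_sum_add has_sum_uminusI) auto
    moreover have "(u x)\<^sup>2 + - (w x)\<^sup>2 = (u x - w x)\<^sup>2" for x by (simp add: w_def)
    ultimately show ?thesis by (simp add: mass_def infsumI)
  qed
  have wv: "mass (\<lambda>x. w x - v x) \<le> m - a"
  proof -
    have "(\<lambda>x. w x - v x) = (\<lambda>x. (1 - t) * w x)"
      by (simp add: v_def fun_eq_iff algebra_simps)
    hence "mass (\<lambda>x. w x - v x) = (1 - t)\<^sup>2 * a" by (simp add: lp2_cmult(2)[OF w] a_def)
    also have "\<dots> = a + t\<^sup>2 * a - 2 * (t * a)" by (simp add: power2_eq_square algebra_simps)
    finally have "mass (\<lambda>x. w x - v x) = a + t\<^sup>2 * a - 2 * (t * a)" .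
    moreover have "t\<^sup>2 * a = m" using \<open>a > 0\<close> m(2) by (simp add: t_def)
    \<comment> \<open>From \<open>t\<close> \<ge> 1 the distance a + m - 2ta is at most m -
      a.\<close>
    moreover have "1 * a \<le> t * a" using \<open>a > 0\<close> \<open>a \<le> m\<close> by (intro mult_right_mono) (auto simp: t_def)
    ultimately show ?thesis by simp
  qed
  have "(\<lambda>x. u x - v x) = (\<lambda>x. (u x - w x) + (w x - v x))" by (simp add: fun_eq_iff)
  hence "mass (\<lambda>x. u x - v x) \<le> 2 * mass (\<lambda>x. u x - w x) + 2 * mass (\<lambda>x. w x - v x)"
    using lp2_add(2)[OF lp2_diff(1)[OF u w] lp2_diff(1)[OF w v(1)]] by simp
  also have "\<dots> \<le> 4 * \<theta>" using a_ge uw wv by simp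
  also have "\<dots> \<le> 4 * (\<epsilon> * \<delta> / (16 * K))"
    unfolding \<theta>_def by (intro mult_left_mono min.cobounded2) simp
  finally have "mass (\<lambda>x. u x - v x) / \<delta> \<le> \<epsilon> / (4 * K)" using \<open>\<delta> > 0\<close> K(1) by (simp add: field_simps)
  moreover have "\<delta> * (mass u + mass v) = \<epsilon> / (4 * K)"
    using K(1) m by (simp add: v(2) \<delta>_def field_simps)
  ultimately have "\<delta> * (mass u + mass v) + mass (\<lambda>x. u x - v x) / \<delta> \<le> \<epsilon> / (2 * K)" by simp
  from mult_left_mono[OF this, of K] K(1)
  have "K * (\<delta> * (mass u + mass v) + mass (\<lambda>x. u x - v x) / \<delta>) \<le> \<epsilon> / 2" by simp
  with K(2)[OF v(1) \<open>\<delta> > 0\<close>] v(2) have "energy F v < energy F u + \<epsilon>"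
    using \<open>\<epsilon> > 0\<close> by linarith
  with \<open>finite {x. v x \<noteq> 0}\<close> v(2) show ?thesis by blast
qed

end

section \<open>The minimal energy\<close>

text \<open>Real-valued counterpart of \<open>ground_energy\<close>, on which ordinary arithmetic is
  available. The two agree for positive mass by \<open>ground_energy_eq\<close>, because the energy
  is bounded below on each sphere.\<close>

definition min_energy :: "'n::finite itself \<Rightarrow> (real \<Rightarrow> real) \<Rightarrow> real \<Rightarrow> real" where
  "min_energy _ F m = (INF u \<in> (mass_sphere m :: (int ^ 'n \<Rightarrow> real) set). energy F u)"

lemma mass_indicator: "finite A \<Longrightarrow> mass (\<lambda>x. if x \<in> A then c else 0) = real (card A) * c\<^sup>2"
  by (subst mass_finite_support) auto

lemma mass_sphere_nonempty:
  assumes "0 \<le> m"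
  shows "(mass_sphere m :: (int ^ 'n \<Rightarrow> real) set) \<noteq> {}"
proof -
  have "(\<lambda>x. if x \<in> {0} then sqrt m else 0) \<in> (mass_sphere m :: (int ^ 'n \<Rightarrow> real) set)"
    unfolding mass_sphere_iff
  proof
    show "(\<lambda>x. if x \<in> {0} then sqrt m else 0) \<in> (lp 2 :: (int ^ 'n \<Rightarrow> real) set)"
      by (intro lp2_finite_support) simp
    show "mass (\<lambda>x :: int ^ 'n. if x \<in> {0} then sqrt m else 0) = m"
      using assms mass_indicator[of "{0 :: int ^ 'n}" "sqrt m"] by simp
  qed
  thus ?thesis by blast
qed

context potential
begin

lemma energy_bdd_below: "bdd_below (energy F ` (mass_sphere m :: (int ^ 'n \<Rightarrow> real) set))"
proof -
  obtain C where "\<And>u :: int ^ 'n \<Rightarrow> real. u \<in> lp 2 \<Longrightarrow> mass u \<le> m \<Longrightarrow> - C * mass u \<le> energy F u"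
    using energy_ge[where 'n = 'n] by blast
  thus ?thesis by (intro bdd_belowI2[where m = "- C * m"]) (auto simp: mass_sphere_iff)
qed

lemma ground_energy_eq:
  assumes "0 < m"
  shows "ground_energy TYPE('n::finite) F m = ereal (min_energy TYPE('n) F m)"
proof -
  let ?S = "mass_sphere m :: (int ^ 'n \<Rightarrow> real) set"
  have "ereal (Inf (energy F ` ?S)) = Inf (ereal ` energy F ` ?S)"
    using mass_sphere_nonempty[of m, where 'n = 'n] assms by (intro ereal_Inf' energy_bdd_below) auto
  thus ?thesis by (simp only: ground_energy_def min_energy_def image_image)
qed

lemma min_energy_le: "u \<in> lp 2 \<Longrightarrow> mass u = m \<Longrightarrow> min_energy TYPE('n) F m \<le> energy F (u :: int ^ 'n \<Rightarrow> real)"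
  unfolding min_energy_def by (intro cINF_lower energy_bdd_below) (simp add: mass_sphere_iff)

lemma min_energy_geI:
  assumes "0 \<le> m" "\<And>u :: int ^ 'n \<Rightarrow> real. u \<in> lp 2 \<Longrightarrow> mass u = m \<Longrightarrow> c \<le> energy F u"
  shows "c \<le> min_energy TYPE('n) F m"
  unfolding min_energy_def using assms mass_sphere_nonempty
  by (intro cINF_greatest) (auto simp: mass_sphere_iff)

lemma min_energy_geI_finite:
  assumes "0 < m" "\<And>u :: int ^ 'n \<Rightarrow> real. finite {x. u x \<noteq> 0} \<Longrightarrow> mass u = m \<Longrightarrow> c \<le> energy F u"
  shows "c \<le> min_energy TYPE('n) F m"
proof (rule min_energy_geI)
  fix u :: "int ^ 'n \<Rightarrow> real" assume u: "u \<in> lp 2" "mass u = m"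
  show "c \<le> energy F u"
  proof (rule field_le_epsilon)
    fix \<epsilon> :: real assume "\<epsilon> > 0"
    then show "c \<le> energy F u + \<epsilon>"
      using finite_support_approximation[OF u \<open>0 < m\<close>] assms(2) by fastforce
  qed
qed (use assms in simp)

text \<open>A competitor of mass \<open>a\<close> becomes one of mass \<open>b\<close> when
  multiplied by the square root of \<open>b / a\<close>. The resulting Lipschitz bound degenerates
  only as \<open>a\<close> tends to 0.\<close>

lemma min_energy_scale:
  "\<exists>K>0. \<forall>a b. 0 < a \<longrightarrow> a \<le> m \<longrightarrow> 0 < b \<longrightarrow> b \<le> m \<longrightarrow>
    min_energy TYPE('n::finite) F b \<le> min_energy TYPE('n) F a + K * \<bar>b - a\<bar> * ((2 * a + b) / a)"
proof -
  obtain K where K: "K > 0" "\<And>(u :: int ^ 'n \<Rightarrow> real) v \<delta>. u \<in> lp 2 \<Longrightarrow> v \<in> lp 2 \<Longrightarrow> \<delta> > 0 \<Longrightarrow>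
      mass u \<le> m \<Longrightarrow> mass v \<le> m \<Longrightarrow>
      \<bar>energy F u - energy F v\<bar> \<le> K * (\<delta> * (mass u + mass v) + mass (\<lambda>x. u x - v x) / \<delta>)"
    using energy_diff[where m = m and 'n = 'n] by blast
  have "min_energy TYPE('n) F b \<le> min_energy TYPE('n) F a + K * \<bar>b - a\<bar> * ((2 * a + b) / a)"
    if ab: "0 < a" "a \<le> m" "0 < b" "b \<le> m" for a b
  proof (cases "b = a")
    case False
    define t where "t = sqrt (b / a)"
    have "t \<ge> 0" and t2: "t\<^sup>2 = b / a" using ab by (simp_all add: t_def)
    have "t \<noteq> 1" using False t2 ab by auto
    have "\<bar>t - 1\<bar> * 1 \<le> \<bar>t - 1\<bar> * \<bar>t + 1\<bar>" using \<open>t \<ge> 0\<close> by (intro mult_left_mono) auto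
    also have "\<dots> = \<bar>t\<^sup>2 - 1\<bar>" by (simp add: abs_mult[symmetric] power2_eq_square algebra_simps)
    also have "\<dots> = \<bar>b - a\<bar> / a" using ab by (simp add: t2 field_simps abs_if)
    finally have t_le: "\<bar>t - 1\<bar> \<le> \<bar>b - a\<bar> / a" by simp
    have "min_energy TYPE('n) F b - K * \<bar>b - a\<bar> * ((2 * a + b) / a) \<le> min_energy TYPE('n) F a"
    proof (rule min_energy_geI)
      fix u :: "int ^ 'n \<Rightarrow> real" assume u: "u \<in> lp 2" "mass u = a"
      define v where "v = (\<lambda>x. t * u x)"
      have v: "v \<in> lp 2" "mass v = b" using lp2_cmult[OF u(1), of t] t2 u(2) ab by (simp_all add: v_def)
      have "(\<lambda>x. u x - v x) = (\<lambda>x. (1 - t) * u x)" by (simp add: v_def fun_eq_iff algebra_simps)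
      hence "mass (\<lambda>x. u x - v x) = \<bar>t - 1\<bar>\<^sup>2 * a"
        by (simp add: lp2_cmult(2)[OF u(1)] u(2) power2_commute[of 1 t])
      \<comment> \<open>With the weight \<open>\<bar>t - 1\<bar>\<close> for \<delta>, both terms of
        \<open>energy_diff\<close> become linear in \<open>\<bar>t - 1\<bar>\<close>.\<close>
      hence "mass (\<lambda>x. u x - v x) / \<bar>t - 1\<bar> = \<bar>t - 1\<bar> * a"
        using \<open>t \<noteq> 1\<close> by (simp add: power2_eq_square del: abs_mult_self_eq)
      hence "\<bar>energy F u - energy F v\<bar> \<le> K * (\<bar>t - 1\<bar> * (2 * a + b))"
        using K(2)[OF u(1) v(1), of "\<bar>t - 1\<bar>"] u(2) v(2) ab \<open>t \<noteq> 1\<close> by (simp add: algebra_simps)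
      also have "\<dots> \<le> K * (\<bar>b - a\<bar> / a * (2 * a + b))"
        using t_le ab K(1) by (intro mult_left_mono mult_right_mono) auto
      also have "\<dots> = K * \<bar>b - a\<bar> * ((2 * a + b) / a)" by simp
      finally have "energy F v - K * \<bar>b - a\<bar> * ((2 * a + b) / a) \<le> energy F u"
        by (simp only: abs_le_iff) linarith
      with min_energy_le[OF v] show "min_energy TYPE('n) F b - K * \<bar>b - a\<bar> * ((2 * a + b) / a) \<le> energy F u"
        by linarith
    qed (use ab in simp)
    thus ?thesis by simp
  qed (use ab K(1) in simp)
  with K(1) show ?thesis by blast
qed

text \<open>Scaling from \<open>m\<close> to \<open>x\<close> bounds the value at \<open>x\<close>
  from above, scaling back from \<open>x\<close> to \<open>m\<close> bounds it from below.
  Restricting to masses up to \<open>m + 1\<close> fixes the constant.\<close>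

lemma min_energy_continuous: "continuous_on {0<..} (min_energy TYPE('n::finite) F)"
proof (clarsimp simp: continuous_on_def)
  fix m :: real assume "m > 0"
  let ?E = "min_energy TYPE('n) F"
  obtain K where K: "\<And>a b. 0 < a \<Longrightarrow> a \<le> m + 1 \<Longrightarrow> 0 < b \<Longrightarrow> b \<le> m + 1 \<Longrightarrow>
      ?E b \<le> ?E a + K * \<bar>b - a\<bar> * ((2 * a + b) / a)"
    using min_energy_scale[where 'n = 'n and m = "m + 1"] by blast
  have ev: "\<forall>\<^sub>F x in at m within {0<..}. 0 < x \<and> x \<le> m + 1"
    unfolding eventually_at by (rule exI[of _ 1]) (auto simp: dist_real_def)
  show "(?E \<longlongrightarrow> ?E m) (at m within {0<..})"
  proof (rule tendsto_sandwich)
    show "\<forall>\<^sub>F x in at m within {0<..}. ?E m - K * \<bar>m - x\<bar> * ((2 * x + m) / x) \<le> ?E x"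
      using ev by eventually_elim (use K[of _ m] \<open>m > 0\<close> in force)
    show "\<forall>\<^sub>F x in at m within {0<..}. ?E x \<le> ?E m + K * \<bar>x - m\<bar> * ((2 * m + x) / m)"
      using ev by eventually_elim (use K[of m] \<open>m > 0\<close> in force)
    have "((\<lambda>x. ?E m - K * \<bar>m - x\<bar> * ((2 * x + m) / x)) \<longlongrightarrow> ?E m - K * \<bar>m - m\<bar> * ((2 * m + m) / m)) (at m within {0<..})"
      using \<open>m > 0\<close> by (intro tendsto_intros) auto
    thus "((\<lambda>x. ?E m - K * \<bar>m - x\<bar> * ((2 * x + m) / x)) \<longlongrightarrow> ?E m) (at m within {0<..})" by simp
    have "((\<lambda>x. ?E m + K * \<bar>x - m\<bar> * ((2 * m + x) / m)) \<longlongrightarrow> ?E m + K * \<bar>m - m\<bar> * ((2 * m + m) / m)) (at m within {0<..})"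
      using \<open>m > 0\<close> by (intro tendsto_intros) auto
    thus "((\<lambda>x. ?E m + K * \<bar>x - m\<bar> * ((2 * m + x) / m)) \<longlongrightarrow> ?E m) (at m within {0<..})" by simp
  qed
qed

end


subsection \<open>Spreading along cubes\<close>

definition cube :: "nat \<Rightarrow> (int ^ 'n) set" where
  "cube k = {x. \<forall>i. x $ i \<in> {- int k..int k}}"

lemma finite_cube: "finite (cube k)"
  unfolding cube_def by (rule finite_box) simp

lemma card_cube: "card (cube k :: (int ^ 'n) set) = (2 * k + 1) ^ CARD('n)"
  unfolding cube_def by (subst card_box) (auto simp: nat_add_distrib nat_mult_distrib)

lemma cube_mono: "k \<le> l \<Longrightarrow> cube k \<subseteq> cube l"
  unfolding cube_def by (intro Collect_mono impI) (auto intro: order_trans[of _ "- int k"] order_trans[of _ "int k"])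

lemma abs_nth_le_ell1: "\<bar>h $ i\<bar> \<le> ell1 h"
  unfolding ell1_def by (rule member_le_sum) auto

lemma cube_add_adj: "x \<in> cube k \<Longrightarrow> adj 0 e \<Longrightarrow> x + e \<in> cube (Suc k)"
proof -
  assume "x \<in> cube k" "adj 0 e"
  hence "- int k \<le> x $ i \<and> x $ i \<le> int k \<and> \<bar>e $ i\<bar> \<le> 1" for i
    using abs_nth_le_ell1[of e i] by (simp add: cube_def adj_0_iff)
  hence "- int (Suc k) \<le> x $ i + e $ i \<and> x $ i + e $ i \<le> int (Suc k)" for i
    by (smt (verit, best) of_nat_Suc)
  thus ?thesis by (simp add: cube_def)
qed

text \<open>A step \<open>e\<close> changes the indicator only where it crosses the boundary of the
  cube. Entering steps start in the outer shell, leaving steps start in the shell shifted by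
  \<open>-e\<close>, so at most twice the size of the shell contributes.\<close>

lemma dirichlet_cube_le:
  "dirichlet (\<lambda>x :: int ^ 'n. if x \<in> cube k then c else 0)
    \<le> 2 * real (card {e :: int ^ 'n. adj 0 e}) * (real (card (cube (Suc k) :: (int ^ 'n) set)) - card (cube k :: (int ^ 'n) set)) * c\<^sup>2"
proof -
  let ?u = "\<lambda>x :: int ^ 'n. if x \<in> cube k then c else 0"
  let ?B = "cube (Suc k) - cube k :: (int ^ 'n) set"
  have fin: "finite ?B" by (simp add: finite_cube)
  have sub: "cube k \<subseteq> (cube (Suc k) :: (int ^ 'n) set)" by (rule cube_mono) simp
  have card_B: "real (card ?B) = real (card (cube (Suc k) :: (int ^ 'n) set)) - card (cube k :: (int ^ 'n) set)"
    using card_Diff_subset[OF finite_cube sub] card_mono[OF finite_cube sub] by simp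
  have "mass (increment e ?u) \<le> 2 * real (card ?B) * c\<^sup>2" if e: "adj 0 e" for e
  proof -
    let ?S = "?B \<union> (\<lambda>y. y - e) ` ?B"
    have S: "finite ?S" using fin by simp
    have supp: "increment e ?u x = 0" if "x \<notin> ?S" for x
    proof (rule ccontr)
      assume "increment e ?u x \<noteq> 0"
      then consider "x \<in> cube k" "x + e \<notin> cube k" | "x \<notin> cube k" "x + e \<in> cube k"
        by (auto simp: increment_def split: if_splits)
      thus False
      proof cases
        case 1
        hence "x + e \<in> ?B" using cube_add_adj[OF _ e] by blast
        hence "x \<in> (\<lambda>y. y - e) ` ?B" by (rule rev_image_eqI) simp
        with that show False by blast
      next
        case 2
        hence "x \<in> ?B" using cube_add_adj[of "x + e" k "- e"] e by (simp add: adj_0_uminus)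
        with that show False by blast
      qed
    qed
    have "mass (increment e ?u) = (\<Sum>x\<in>?S. (increment e ?u x)\<^sup>2)"
      by (rule mass_finite_support[OF S supp])
    also have "\<dots> \<le> (\<Sum>x\<in>?S. c\<^sup>2)"
      by (intro sum_mono) (auto simp: increment_def)
    also have "\<dots> = real (card ?S) * c\<^sup>2" by simp
    also have "card ?S \<le> card ?B + card ?B"
      using card_Un_le[of ?B "(\<lambda>y. y - e) ` ?B"] card_image_le[OF fin, of "\<lambda>y. y - e"] by linarith
    finally show ?thesis by (simp add: mult_right_mono)
  qed
  hence "dirichlet ?u \<le> (\<Sum>e :: int ^ 'n | adj 0 e. 2 * real (card ?B) * c\<^sup>2)"
    unfolding dirichlet_def by (intro sum_mono) simp
  thus ?thesis by (simp add: card_B algebra_simps)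
qed

context potential
begin

text \<open>On a cube of fixed mass \<open>m\<close> the Dirichlet term is controlled by the
  relative growth of volume from one cube to the next, which tends to 0. The height tends to 0 as
  well, so \<open>F_small\<close> with \<open>\<epsilon> / m\<close> bounds the potential term by
  \<epsilon>.\<close>

lemma min_energy_nonpos:
  assumes "m > 0"
  shows "min_energy TYPE('n::finite) F m \<le> 0"
proof (rule field_le_epsilon)
  fix \<epsilon> :: real assume "\<epsilon> > 0"
  obtain \<rho> where \<rho>: "\<rho> > 0" "\<And>t. \<bar>t\<bar> \<le> \<rho> \<Longrightarrow> \<bar>F t\<bar> \<le> \<epsilon> / m * t\<^sup>2"
    using F_small[of "\<epsilon> / m"] \<open>\<epsilon> > 0\<close> \<open>m > 0\<close> by auto
  define n where "n k = real (card (cube k :: (int ^ 'n) set))" for k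
  define d where "d = real (card {e :: int ^ 'n. adj 0 e})"
  define c where "c k = sqrt (m / n k)" for k
  have n: "n k = (2 * real k + 1) ^ CARD('n)" for k by (simp add: n_def card_cube add.commute)
  have n_pos: "n k > 0" for k by (simp add: n)
  have c2: "n k * (c k)\<^sup>2 = m" for k using n_pos[of k] \<open>m > 0\<close> by (simp add: c_def)
  \<comment> \<open>The volume \<open>n k\<close> is at least \<open>k\<close>, so the squared
    height \<open>m / n k\<close> drops below the square of \<rho> once \<open>k\<close> exceeds
    \<open>m / \<rho>\<^sup>2\<close>.\<close>
  have small: "c k \<le> \<rho>" if "k \<ge> nat \<lceil>m / \<rho>\<^sup>2\<rceil>" for k
  proof -
    have "m / \<rho>\<^sup>2 \<le> real k" using that by linarith
    also have "\<dots> \<le> (2 * real k + 1) ^ 1" by simp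
    also have "\<dots> \<le> n k" unfolding n by (intro power_increasing) (auto simp: Suc_leI)
    finally have "m / n k \<le> \<rho>\<^sup>2" using \<rho>(1) n_pos[of k] by (simp add: field_simps)
    thus ?thesis unfolding c_def using \<rho>(1) by (simp add: real_le_lsqrt)
  qed
  have bound: "min_energy TYPE('n) F m \<le> d / 2 * m * (n (Suc k) / n k - 1) + \<epsilon>"
    if k: "k \<ge> nat \<lceil>m / \<rho>\<^sup>2\<rceil>" for k
  proof -
    let ?u = "\<lambda>x :: int ^ 'n. if x \<in> cube k then c k else 0"
    have u: "?u \<in> lp 2" by (rule lp2_finite_support, rule finite_subset[OF _ finite_cube[of k]]) auto
    have "mass ?u = m" using c2 by (simp add: mass_indicator finite_cube n_def)
    hence "min_energy TYPE('n) F m \<le> energy F ?u" by (intro min_energy_le u)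
    also have "\<dots> = 1/4 * dirichlet ?u - (\<Sum>\<^sub>\<infinity>x. F (?u x))" by (rule energy_eq[OF u])
    also have "(\<Sum>\<^sub>\<infinity>x. F (?u x)) = (\<Sum>\<^sub>\<infinity>x\<in>(cube k :: (int ^ 'n) set). F (c k))"
      by (rule infsum_cong_neutral) (auto simp: F_0)
    also have "\<dots> = n k * F (c k)" by (simp add: finite_cube n_def)
    also have "- (n k * F (c k)) \<le> \<epsilon>"
    proof -
      have "c k \<ge> 0" using n_pos[of k] \<open>m > 0\<close> by (simp add: c_def)
      hence "- F (c k) \<le> \<epsilon> / m * (c k)\<^sup>2" using \<rho>(2)[of "c k"] small[OF k] by linarith
      hence "n k * - F (c k) \<le> n k * (\<epsilon> / m * (c k)\<^sup>2)" using n_pos[of k] by (intro mult_left_mono) auto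
      also have "\<dots> = \<epsilon> / m * (n k * (c k)\<^sup>2)" by simp
      also have "\<dots> = \<epsilon>" unfolding c2 using \<open>m > 0\<close> by simp
      finally show ?thesis by simp
    qed
    hence "1/4 * dirichlet ?u - n k * F (c k) \<le> 1/4 * dirichlet ?u + \<epsilon>" by simp
    also have "dirichlet ?u \<le> 2 * d * (n (Suc k) - n k) * (c k)\<^sup>2"
      unfolding d_def n_def by (rule dirichlet_cube_le)
    also have "1/4 * (2 * d * (n (Suc k) - n k) * (c k)\<^sup>2) = d / 2 * m * (n (Suc k) / n k - 1)"
      unfolding c2[of k, symmetric] using n_pos[of k] by (simp add: field_simps)
    finally show ?thesis by simp
  qed
  have "(\<lambda>k. (2 * real (Suc k) + 1) / (2 * real k + 1)) \<longlonglongrightarrow> 1"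
  proof -
    have "(\<lambda>k. 1 + 1 / real (Suc k) * (2 * real (Suc k) / (2 * real k + 1))) \<longlonglongrightarrow> 1 + 0 * 1"
    proof (intro tendsto_intros)
      show "(\<lambda>k. 1 / real (Suc k)) \<longlonglongrightarrow> 0" by (rule lim_1_over_n[THEN LIMSEQ_Suc])
      show "(\<lambda>k. 2 * real (Suc k) / (2 * real k + 1)) \<longlonglongrightarrow> 1" by real_asymp
    qed
    thus ?thesis by real_asymp
  qed
  hence "(\<lambda>k. ((2 * real (Suc k) + 1) / (2 * real k + 1)) ^ CARD('n)) \<longlonglongrightarrow> 1 ^ CARD('n)"
    by (rule tendsto_power)
  hence "(\<lambda>k. n (Suc k) / n k) \<longlonglongrightarrow> 1" by (simp add: n power_divide)
  hence "(\<lambda>k. d / 2 * m * (n (Suc k) / n k - 1) + \<epsilon>) \<longlonglongrightarrow> d / 2 * m * (1 - 1) + \<epsilon>"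
    by (intro tendsto_intros)
  hence "(\<lambda>k. d / 2 * m * (n (Suc k) / n k - 1) + \<epsilon>) \<longlonglongrightarrow> 0 + \<epsilon>" by simp
  thus "min_energy TYPE('n) F m \<le> 0 + \<epsilon>"
    by (rule LIMSEQ_le_const) (use bound in blast)
qed

end

subsection \<open>Superposition of distant functions\<close>

lemma infinite_lattice: "infinite (UNIV :: (int ^ 'n) set)"
proof
  assume "finite (UNIV :: (int ^ 'n) set)"
  hence "finite (range (\<lambda>s :: int. axis undefined s :: int ^ 'n))" by (rule rev_finite_subset) simp
  moreover have "inj (\<lambda>s :: int. axis undefined s :: int ^ 'n)" by (rule injI) (auto simp: axis_eq_axis)
  ultimately show False using finite_imageD infinite_UNIV_int by blast
qed

text \<open>Only the finitely many differences \<open>y - x - e\<close> are forbidden. The case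
  \<open>e = 0\<close> separates the supports; the unit vectors also exclude edges between
  them.\<close>

lemma exists_separating_translation:
  fixes A B :: "(int ^ 'n) set"
  assumes "finite A" "finite B"
  shows "\<exists>h. \<forall>x\<in>A. \<forall>e. e = 0 \<or> adj 0 e \<longrightarrow> x + e + h \<notin> B"
proof -
  let ?E = "insert 0 {e :: int ^ 'n. adj 0 e}"
  have "finite ((\<lambda>(x, e, y). y - x - e) ` (A \<times> ?E \<times> B))"
    using assms by (intro finite_imageI finite_cartesian_product) (auto simp: finite_adj)
  then obtain h where "h \<notin> (\<lambda>(x, e, y). y - x - e) ` (A \<times> ?E \<times> B)"
    using ex_new_if_finite[OF infinite_lattice] by blast
  hence h: "x + e + h \<noteq> y" if "x \<in> A" "e \<in> ?E" "y \<in> B" for x e y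
    using that by (force simp: image_iff algebra_simps)
  show ?thesis by (rule exI[of _ h]) (use h in blast)
qed

lemma mass_add_disjoint:
  assumes "p \<in> lp 2" "q \<in> lp 2" "\<And>x. p x = 0 \<or> q x = 0"
  shows "mass (\<lambda>x. p x + q x) = mass p + mass q"
proof -
  have "(p x + q x)\<^sup>2 = (p x)\<^sup>2 + (q x)\<^sup>2" for x using assms(3)[of x] by auto
  thus ?thesis
    using infsumI[OF has_sum_add[OF lp2_has_sum[OF assms(1)] lp2_has_sum[OF assms(2)]]]
    by (simp add: mass_def)
qed

context potential
begin

lemma energy_translate: "u \<in> lp 2 \<Longrightarrow> energy F (\<lambda>x. u (x + h)) = energy F u"
  using infsum_translate[of "\<lambda>x. F (u x)" h]
  by (simp add: energy_eq lp2_translate dirichlet_translate)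

lemma energy_add_separated:
  assumes u: "u \<in> lp 2" and w: "w \<in> lp 2"
    and sep: "\<And>x e. e = 0 \<or> adj 0 e \<Longrightarrow> u x = 0 \<or> w (x + e) = 0"
  shows "energy F (\<lambda>x. u x + w x) = energy F u + energy F w"
proof -
  have "mass (increment e (\<lambda>x. u x + w x)) = mass (increment e u) + mass (increment e w)"
    if e: "adj 0 e" for e
  proof -
    \<comment> \<open>An increment sees the points \<open>x\<close> and \<open>x + e\<close>.
      Direction 0 at either point separates the supports; \<open>e\<close> and \<open>-e\<close>
      exclude the two orientations of the edge.\<close>
    have "increment e u x = 0 \<or> increment e w x = 0" for x
      using sep[of 0 x] sep[of e x] sep[of "-e" "x + e"] sep[of 0 "x + e"] e
      by (auto simp: increment_def adj_0_uminus)
    hence "mass (\<lambda>x. increment e u x + increment e w x) = mass (increment e u) + mass (increment e w)"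
      using u w by (intro mass_add_disjoint lp2_increment)
    moreover have "increment e (\<lambda>x. u x + w x) = (\<lambda>x. increment e u x + increment e w x)"
      by (simp add: increment_def fun_eq_iff)
    ultimately show ?thesis by simp
  qed
  hence "dirichlet (\<lambda>x. u x + w x) = dirichlet u + dirichlet w"
    by (simp add: dirichlet_def sum.distrib)
  moreover have "F (u x + w x) = F (u x) + F (w x)" for x
    using sep[of 0 x] by (auto simp: F_0)
  hence "(\<Sum>\<^sub>\<infinity>x. F (u x + w x)) = (\<Sum>\<^sub>\<infinity>x. F (u x)) + (\<Sum>\<^sub>\<infinity>x. F (w x))"
    using infsumI[OF has_sum_add[OF F_has_sum[OF u] F_has_sum[OF w]]] by simp
  ultimately show ?thesis using u w by (simp add: energy_eq lp2_add(1))
qed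

text \<open>The additional mass \<open>b - a\<close> is put into a distant function of energy below
  \<epsilon>, which exists because the minimal energy of mass \<open>b - a\<close> is at most
  0.\<close>

lemma min_energy_antimono:
  assumes "0 < a" "a \<le> b"
  shows "min_energy TYPE('n::finite) F b \<le> min_energy TYPE('n) F a"
proof (cases "a = b")
  case False
  show ?thesis
  proof (rule min_energy_geI_finite[OF \<open>0 < a\<close>])
    fix u :: "int ^ 'n \<Rightarrow> real" assume supp_u: "finite {x. u x \<noteq> 0}" and "mass u = a"
    show "min_energy TYPE('n) F b \<le> energy F u"
    proof (rule field_le_epsilon)
      fix \<epsilon> :: real assume "\<epsilon> > 0"
      have "\<not> \<epsilon> \<le> min_energy TYPE('n) F (b - a)"
        using min_energy_nonpos[of "b - a", where 'n = 'n] False assms \<open>\<epsilon> > 0\<close> by linarith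
      hence "\<exists>v :: int ^ 'n \<Rightarrow> real. finite {x. v x \<noteq> 0} \<and> mass v = b - a \<and> \<not> \<epsilon> \<le> energy F v"
        using min_energy_geI_finite[of "b - a" \<epsilon>, where 'n = 'n] False assms by force
      then obtain v :: "int ^ 'n \<Rightarrow> real"
        where supp_v: "finite {x. v x \<noteq> 0}" and v: "mass v = b - a" "energy F v < \<epsilon>" by force
      obtain h where h: "\<And>x e. u x \<noteq> 0 \<Longrightarrow> e = 0 \<or> adj 0 e \<Longrightarrow> v (x + e + h) = 0"
        using exists_separating_translation[OF supp_u supp_v] by blast
      define w where "w = (\<lambda>x. v (x + h))"
      have lp2: "u \<in> lp 2" "v \<in> lp 2" "w \<in> lp 2"
        using supp_u supp_v by (auto simp: w_def lp2_translate intro: lp2_finite_support)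
      have sep: "u x = 0 \<or> w (x + e) = 0" if "e = 0 \<or> adj 0 e" for x e
        using h[OF _ that] by (auto simp: w_def)
      have "mass (\<lambda>x. u x + w x) = mass u + mass w"
        using sep[of 0] by (intro mass_add_disjoint lp2) auto
      also have "\<dots> = b" by (simp add: \<open>mass u = a\<close> w_def mass_translate v(1))
      finally have "min_energy TYPE('n) F b \<le> energy F (\<lambda>x. u x + w x)"
        by (intro min_energy_le lp2_add(1) lp2)
      also have "\<dots> = energy F u + energy F v"
        using energy_add_separated[OF lp2(1,3) sep] energy_translate[OF lp2(2), of h] by (simp add: w_def)
      finally show "min_energy TYPE('n) F b \<le> energy F u + \<epsilon>" using v(2) by linarith
    qed
  qed
qed simp

section \<open>The threshold mass\<close>

lemma threshold_exists: "\<exists>!ms. is_threshold TYPE('n::finite) F ms"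
proof -
  let ?E = "min_energy TYPE('n) F"
  \<comment> \<open>Inserting 0 keeps the supremum nonnegative: in \<open>ereal\<close> the supremum
    of the empty set would be \<open>-\<infinity>\<close>.\<close>
  define ms where "ms = Sup (insert 0 (ereal ` {m. 0 < m \<and> ?E m = 0}))"
  have E_eq: "ground_energy TYPE('n) F m = ereal (?E m)" if "0 < m" for m
    by (rule ground_energy_eq[OF that])
  have zero: "?E m = 0" if m: "0 < m" "ereal m \<le> ms" for m
  proof (rule ccontr)
    assume "?E m \<noteq> 0"
    hence "?E m < 0" using min_energy_nonpos[OF m(1), where 'n = 'n] by linarith
    \<comment> \<open>Continuity shows that the supremum itself has energy 0: a negative value at
      \<open>m\<close> would persist at some smaller \<open>a\<close>, and by monotonicity no mass
      from \<open>a\<close> on could have energy 0.\<close>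
    have "isCont ?E m"
      using min_energy_continuous[where 'n = 'n] m(1) by (simp add: continuous_on_eq_continuous_at)
    hence "\<forall>\<^sub>F x in nhds m. ?E x < 0"
      using \<open>?E m < 0\<close> order_tendstoD(2)[of ?E "?E m" "nhds m" 0] by (simp add: isCont_def tendsto_at_iff_tendsto_nhds)
    then obtain d where d: "d > 0" "\<And>x. dist x m < d \<Longrightarrow> ?E x < 0"
      unfolding eventually_nhds_metric by blast
    define a where "a = max (m / 2) (m - d / 2)"
    have a: "0 < a" "a < m" "dist a m < d" using d(1) m(1) by (auto simp: a_def dist_real_def)
    have "ms \<le> ereal a"
      unfolding ms_def
    proof (rule Sup_least)
      fix x assume "x \<in> insert 0 (ereal ` {m. 0 < m \<and> ?E m = 0})"
      then consider "x = 0" | y where "x = ereal y" "0 < y" "?E y = 0" by blast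
      thus "x \<le> ereal a"
      proof cases
        case 2
        have "\<not> a \<le> y" using min_energy_antimono[OF a(1), of y, where 'n = 'n] d(2)[OF a(3)] 2(3) by linarith
        thus ?thesis using 2(1) by simp
      qed (use a(1) in \<open>simp add: zero_ereal_def\<close>)
    qed
    with m(2) a(2) show False using order_trans[of "ereal m" ms "ereal a"] by simp
  qed
  have neg: "?E m < 0" if m: "0 < m" "ms < ereal m" for m
  proof -
    have "?E m \<noteq> 0"
    proof
      assume "?E m = 0"
      hence "ereal m \<le> ms" unfolding ms_def using m(1) by (intro Sup_upper) auto
      with m(2) show False by simp
    qed
    thus ?thesis using min_energy_nonpos[OF m(1), where 'n = 'n] by linarith
  qed
  have "0 \<le> ms" unfolding ms_def by (intro Sup_upper) simp
  hence "is_threshold TYPE('n) F ms"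
    unfolding is_threshold_def using zero neg by (auto simp: E_eq)
  \<comment> \<open>Uniqueness: a real mass strictly between two thresholds would have both negative
    and zero minimal energy.\<close>
  moreover have "\<not> a < b" if a: "is_threshold TYPE('n) F a" and b: "is_threshold TYPE('n) F b" for a b
  proof
    assume "a < b"
    then obtain r where r: "a < r" "r < b" using dense by blast
    moreover have "0 \<le> a" using a by (simp add: is_threshold_def)
    ultimately obtain m where "r = ereal m" by (cases r) auto
    with r \<open>0 \<le> a\<close> have m: "0 < m" "a < ereal m" "ereal m < b"
      using le_less_trans[of 0 a "ereal m"] by auto
    hence "ground_energy TYPE('n) F m < 0" "ground_energy TYPE('n) F m = 0"
      using a b less_imp_le unfolding is_threshold_def by blast+
    thus False by simp
  qed
  ultimately show ?thesis by (metis linorder_cases)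
qed

lemma threshold_cases:
  assumes "is_threshold TYPE('n::finite) F ms" "0 < m"
  shows "ereal m \<le> ms \<Longrightarrow> min_energy TYPE('n) F m = 0"
    and "ms < ereal m \<Longrightarrow> min_energy TYPE('n) F m < 0"
  using assms by (auto simp: is_threshold_def ground_energy_eq)

text \<open>The test function is a spike of height \<zeta> at the origin, of mass
  \<open>\<zeta>\<^sup>2\<close>. The coarse bound \<open>dirichlet_le\<close> with at most 2N
  neighbours gives a kinetic term of at most \<open>2 * N * \<zeta>\<^sup>2\<close>, the constant of
  the hypothesis, so the spike has negative energy.\<close>

lemma threshold_less:
  assumes th: "is_threshold TYPE('n::finite) F ms"
    and "\<zeta> > 0" "F \<zeta> - 2 * real CARD('n) * \<zeta>\<^sup>2 > 0"
  shows "ms < ereal (\<zeta>\<^sup>2)"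
proof (rule ccontr)
  let ?u = "\<lambda>x :: int ^ 'n. if x \<in> {0} then \<zeta> else 0"
  assume "\<not> ms < ereal (\<zeta>\<^sup>2)"
  hence "min_energy TYPE('n) F (\<zeta>\<^sup>2) = 0" using threshold_cases(1)[OF th, of "\<zeta>\<^sup>2"] \<open>\<zeta> > 0\<close> by simp
  moreover have u: "?u \<in> lp 2" by (intro lp2_finite_support) simp
  have m: "mass ?u = \<zeta>\<^sup>2" by (subst mass_indicator) auto
  ultimately have "0 \<le> energy F ?u" using min_energy_le[OF u m] by simp
  also have "(\<Sum>\<^sub>\<infinity>x. F (?u x)) = (\<Sum>\<^sub>\<infinity>x\<in>{0 :: int ^ 'n}. F \<zeta>)"
    by (rule infsum_cong_neutral) (auto simp: F_0)
  hence "energy F ?u = 1/4 * dirichlet ?u - F \<zeta>" unfolding energy_eq[OF u] by simp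
  also have "dirichlet ?u \<le> 4 * real (card {e :: int ^ 'n. adj 0 e}) * \<zeta>\<^sup>2"
    using dirichlet_le[OF u] by (simp only: m)
  also have "real (card {e :: int ^ 'n. adj 0 e}) \<le> 2 * real CARD('n)"
    using card_adj_0_le[where 'n = 'n] by linarith
  finally have "0 \<le> 1/4 * (4 * (2 * real CARD('n)) * \<zeta>\<^sup>2) - F \<zeta>"
    by (simp add: mult_right_mono)
  with assms(3) show False by simp
qed

section \<open>Amplitude scaling and non-attainment below the threshold\<close>

lemma energy_cmult:
  "u \<in> lp 2 \<Longrightarrow> energy F (\<lambda>x. t * u x) = t\<^sup>2 * (1/4 * dirichlet u) - (\<Sum>\<^sub>\<infinity>x. F (t * u x))"
  by (simp add: energy_eq lp2_cmult(1) dirichlet_cmult)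

text \<open>A minimiser would have energy 0. Multiplying it by \<open>t > 1\<close> multiplies the
  kinetic term by the square of \<open>t\<close> but the potential term by strictly more, so a mass
  \<open>b > m\<close> that is still below or at the threshold would admit negative energy.\<close>

lemma min_energy_not_attained:
  assumes th: "is_threshold TYPE('n::finite) F ms"
    and anti: "strict_antimono_on {..<0} (\<lambda>t. F t / t\<^sup>2)" and mono: "strict_mono_on {0<..} (\<lambda>t. F t / t\<^sup>2)"
    and m: "0 < m" "ereal m < ms" and u: "u \<in> lp 2" "mass u = m"
  shows "energy F (u :: int ^ 'n \<Rightarrow> real) \<noteq> min_energy TYPE('n) F m"
proof
  assume eq: "energy F u = min_energy TYPE('n) F m"
  have "min_energy TYPE('n) F m = 0" using threshold_cases(1)[OF th m(1)] m(2) by simp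
  with eq have E0: "energy F u = 0" by simp
  obtain r where r: "ereal m < r" "r < ms" using dense[OF m(2)] by blast
  then obtain b where b: "m < b" "ereal b \<le> ms" by (cases r) auto
  define t where "t = sqrt (b / m)"
  have t2: "t\<^sup>2 = b / m" using b m(1) by (simp add: t_def)
  have "t > 1" using b m(1) by (simp add: t_def)
  have grow: "t\<^sup>2 * F s < F (t * s)" if "s \<noteq> 0" for s
  proof -
    have "F s / s\<^sup>2 < F (t * s) / (t * s)\<^sup>2"
    proof (cases "s > 0")
      case True
      thus ?thesis using strict_mono_onD[OF mono, of s "t * s"] \<open>t > 1\<close> by simp
    next
      case False
      hence "s < 0" "t * s < s" using that \<open>t > 1\<close> by auto
      thus ?thesis using monotone_onD[OF anti, of "t * s" s] \<open>t > 1\<close> by simp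
    qed
    thus ?thesis using that \<open>t > 1\<close> by (simp add: field_simps power_mult_distrib)
  qed
  obtain x0 where x0: "u x0 \<noteq> 0" using u m(1) mass_eq_0_iff[OF u(1)] by (auto simp: fun_eq_iff)
  have "((\<lambda>x. t\<^sup>2 * F (u x)) has_sum t\<^sup>2 * (\<Sum>\<^sub>\<infinity>x. F (u x))) UNIV"
    by (intro has_sum_cmult_right F_has_sum u(1))
  moreover have "((\<lambda>x. F (t * u x)) has_sum (\<Sum>\<^sub>\<infinity>x. F (t * u x))) UNIV"
    using F_has_sum[OF lp2_cmult(1)[OF u(1), of t]] .
  moreover have "t\<^sup>2 * F (u x) \<le> F (t * u x)" for x
    using grow[of "u x"] by (cases "u x = 0") (auto simp: F_0)
  ultimately have "t\<^sup>2 * (\<Sum>\<^sub>\<infinity>x. F (u x)) < (\<Sum>\<^sub>\<infinity>x. F (t * u x))"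
    by (rule has_sum_strict_mono) (use grow[OF x0] in auto)
  hence "energy F (\<lambda>x. t * u x) < t\<^sup>2 * energy F u"
    unfolding energy_cmult[OF u(1)] energy_eq[OF u(1)] right_diff_distrib by linarith
  hence "energy F (\<lambda>x. t * u x) < 0" by (simp add: E0)
  moreover have "mass (\<lambda>x. t * u x) = b" using m(1) by (simp add: lp2_cmult(2)[OF u(1)] u(2) t2)
  hence "min_energy TYPE('n) F b \<le> energy F (\<lambda>x. t * u x)"
    by (intro min_energy_le lp2_cmult(1) u(1))
  moreover have "min_energy TYPE('n) F b = 0" using threshold_cases(1)[OF th, of b] b m(1) by simp
  ultimately show False by simp
qed

end


section \<open>A Gagliardo--Nirenberg inequality\<close>

text \<open>A triangle inequality with adjustable weights: in the path induction below, the choice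
  \<open>1 / n\<close> for \<delta> yields exactly \<open>(n + 1)\<^sup>2\<close>, whereas equal
  weights would make the constant grow exponentially.\<close>

lemma mass_add_weighted:
  assumes "p \<in> lp 2" "q \<in> lp 2" "\<delta> > 0"
  shows "mass (\<lambda>x. p x + q x) \<le> (1 + \<delta>) * mass p + (1 + 1 / \<delta>) * mass q"
proof (rule has_sum_mono[OF lp2_has_sum])
  show "(\<lambda>x. p x + q x) \<in> lp 2" using assms by (intro lp2_add)
  show "((\<lambda>x. (1 + \<delta>) * (p x)\<^sup>2 + (1 + 1 / \<delta>) * (q x)\<^sup>2) has_sum
      (1 + \<delta>) * mass p + (1 + 1 / \<delta>) * mass q) UNIV"
    using assms by (intro has_sum_add has_sum_cmult_right lp2_has_sum)
  fix x
  have "0 \<le> (\<delta> * p x - q x)\<^sup>2 / \<delta>" using assms(3) by simp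
  also have "\<dots> = \<delta> * (p x)\<^sup>2 + 1 / \<delta> * (q x)\<^sup>2 - 2 * p x * q x"
    using assms(3) by (simp add: power2_eq_square field_simps)
  finally show "(p x + q x)\<^sup>2 \<le> (1 + \<delta>) * (p x)\<^sup>2 + (1 + 1 / \<delta>) * (q x)\<^sup>2"
    by (simp add: power2_sum algebra_simps)
qed

text \<open>Along a shortest path from 0 to \<open>h\<close>, the increment splits into a translated
  increment over \<open>h - e\<close> and one over the unit step \<open>e\<close>. The weights
  combine as (1 + 1/n) n^2 + (1 + n) = (n + 1)^2.\<close>

lemma mass_increment_ell1:
  assumes u: "u \<in> lp 2"
  shows "ell1 h = int n \<Longrightarrow> mass (increment h u) \<le> (real n)\<^sup>2 * dirichlet u"
proof (induction n arbitrary: h)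
  case 0
  thus ?case by (simp add: ell1_eq_0_iff increment_def mass_def)
next
  case (Suc n)
  have "h \<noteq> 0" using Suc.prems ell1_eq_0_iff[of h] by auto
  then obtain i s where s: "s \<in> {1, -1}" and step: "ell1 (h - axis i s) = ell1 h - 1"
    using ell1_step by blast
  define e where "e = axis i s"
  define g where "g = h - e"
  have e: "adj 0 e" using s by (auto simp: e_def adj_0_iff ell1_axis)
  have g: "ell1 g = int n" using step Suc.prems by (simp add: g_def e_def)
  have bound_e: "mass (increment e u) \<le> dirichlet u" by (rule mass_increment_le_dirichlet[OF e])
  show ?case
  proof (cases "n = 0")
    case True
    hence "h = e" using g ell1_eq_0_iff[of g] by (simp add: g_def)
    thus ?thesis using bound_e True by simp
  next
    case False
    have "increment h u = (\<lambda>x. increment g u (x + e) + increment e u x)"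
      by (simp add: increment_def g_def fun_eq_iff algebra_simps)
    hence "mass (increment h u) \<le> (1 + 1 / n) * mass (\<lambda>x. increment g u (x + e)) + (1 + 1 / (1 / n)) * mass (increment e u)"
      using mass_add_weighted[of "\<lambda>x. increment g u (x + e)" "increment e u" "1 / n"] False u
      by (simp only:) (simp add: lp2_translate lp2_increment)
    also have "mass (\<lambda>x. increment g u (x + e)) \<le> (real n)\<^sup>2 * dirichlet u"
      using Suc.IH[OF g] by (simp add: mass_translate)
    also note bound_e
    also have "(1 + 1 / n) * ((real n)\<^sup>2 * dirichlet u) + (1 + 1 / (1 / n)) * dirichlet u
        = (real (Suc n))\<^sup>2 * dirichlet u"
      using False by (simp add: power2_eq_square field_simps)
    finally show ?thesis by (simp add: add_left_mono mult_left_mono)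
  qed
qed

text \<open>Averaging \<open>mass v = (\<Sum>x. v x * v (x + h)) + mass (increment h v) / 2\<close> over all \<open>h\<close> in a
  box of side \<open>L\<close>, the correlation term is controlled by the size of the support.\<close>

lemma mass_le_dirichlet_of_small_support:
  fixes v :: "int ^ 'n \<Rightarrow> real"
  assumes A: "finite A" "\<And>x. x \<notin> A \<Longrightarrow> v x = 0" and nonneg: "\<And>x. 0 \<le> v x"
    and L: "2 * card A \<le> L ^ CARD('n)" "L > 0"
  shows "mass v \<le> (real CARD('n) * L)\<^sup>2 * dirichlet v"
proof -
  define H where "H = {h :: int ^ 'n. \<forall>i. h $ i \<in> {0..<int L}}"
  have H: "finite H" "card H = L ^ CARD('n)"
    unfolding H_def by (rule finite_box, simp) (subst card_box, simp_all)
  have v: "v \<in> lp 2" by (rule lp2_finite_support, rule finite_subset[OF _ A(1)]) (use A(2) in auto)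
  have incr: "mass (increment h v) \<le> (real CARD('n) * L)\<^sup>2 * dirichlet v" if "h \<in> H" for h
  proof -
    have "ell1 h \<le> (\<Sum>i\<in>(UNIV :: 'n set). int L)"
      unfolding ell1_def using that by (intro sum_mono) (auto simp: H_def abs_le_iff intro: less_imp_le)
    hence "nat (ell1 h) \<le> CARD('n) * L" by (simp add: nat_le_iff)
    hence "(real (nat (ell1 h)))\<^sup>2 \<le> (real CARD('n) * L)\<^sup>2"
      by (intro power_mono) (simp_all flip: of_nat_mult)
    hence "(real (nat (ell1 h)))\<^sup>2 * dirichlet v \<le> (real CARD('n) * L)\<^sup>2 * dirichlet v"
      by (rule mult_right_mono[OF _ dirichlet_nonneg])
    moreover have "mass (increment h v) \<le> (real (nat (ell1 h)))\<^sup>2 * dirichlet v"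
      by (rule mass_increment_ell1[OF v]) (simp add: ell1_nonneg)
    ultimately show ?thesis by linarith
  qed
  have correlation: "mass v = (\<Sum>x\<in>A. v x * v (x + h)) + mass (increment h v) / 2" for h
  proof -
    let ?p = "\<lambda>x. v x * v (x + h)"
    have "(?p has_sum (\<Sum>x\<in>A. ?p x)) UNIV"
      by (rule has_sum_cong_neutral[THEN iffD1, OF _ _ _ has_sum_finite[OF A(1)]]) (use A(2) in auto)
    hence "((\<lambda>x. (v (x + h))\<^sup>2 + (v x)\<^sup>2 + (- 2) * ?p x) has_sum
        (mass (\<lambda>x. v (x + h)) + mass v + (- 2) * (\<Sum>x\<in>A. ?p x))) UNIV"
      using v by (intro has_sum_add has_sum_cmult_right lp2_has_sum) (simp_all add: lp2_translate)
    moreover have "(v (x + h))\<^sup>2 + (v x)\<^sup>2 + (- 2) * ?p x = (increment h v x)\<^sup>2" for x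
      by (simp add: increment_def power2_diff)
    ultimately have "mass (increment h v) = mass v + mass v + (- 2) * (\<Sum>x\<in>A. ?p x)"
      by (simp add: mass_def[of "increment h v"] infsumI mass_translate)
    thus ?thesis by linarith
  qed
  \<comment> \<open>For fixed \<open>x\<close> the shifts in the box reach distinct points, and only
    those in \<open>A\<close> contribute.\<close>
  have overlap: "(\<Sum>h\<in>H. v (x + h)) \<le> (\<Sum>y\<in>A. v y)" for x
  proof -
    have "(\<Sum>h\<in>H. v (x + h)) = (\<Sum>y\<in>(+) x ` H. v y)" by (subst sum.reindex) auto
    also have "\<dots> = (\<Sum>y\<in>(+) x ` H \<inter> A. v y)"
      using H(1) A by (intro sum.mono_neutral_right) auto
    also have "\<dots> \<le> (\<Sum>y\<in>A. v y)" using A nonneg by (intro sum_mono2) auto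
    finally show ?thesis .
  qed
  have "card H * mass v = (\<Sum>h\<in>H. mass v)" by simp
  also have "\<dots> = (\<Sum>h\<in>H. (\<Sum>x\<in>A. v x * v (x + h)) + mass (increment h v) / 2)"
    using correlation by (intro sum.cong) auto
  also have "\<dots> = (\<Sum>x\<in>A. v x * (\<Sum>h\<in>H. v (x + h))) + (\<Sum>h\<in>H. mass (increment h v) / 2)"
    unfolding sum.distrib by (subst sum.swap) (simp add: sum_distrib_left)
  also have "(\<Sum>x\<in>A. v x * (\<Sum>h\<in>H. v (x + h))) \<le> (\<Sum>x\<in>A. v x * (\<Sum>y\<in>A. v y))"
    by (intro sum_mono mult_left_mono overlap nonneg)
  also have "\<dots> = (\<Sum>x\<in>A. v x)\<^sup>2" by (simp add: power2_eq_square sum_distrib_right)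
  also have "\<dots> \<le> real (card A) * (\<Sum>x\<in>A. (v x)\<^sup>2)"
    using sum_squared_le_sum_of_squares[of v A] by (simp add: mult.commute)
  also have "(\<Sum>x\<in>A. (v x)\<^sup>2) = mass v" by (rule mass_finite_support[OF A, symmetric])
  also have "(\<Sum>h\<in>H. mass (increment h v) / 2) \<le> (\<Sum>h\<in>H. (real CARD('n) * L)\<^sup>2 * dirichlet v / 2)"
    by (intro sum_mono divide_right_mono incr) auto
  also have "\<dots> = card H * ((real CARD('n) * L)\<^sup>2 * dirichlet v) / 2" by simp
  finally have main: "card H * mass v \<le> card A * mass v + card H * ((real CARD('n) * L)\<^sup>2 * dirichlet v) / 2"
    by simp
  \<comment> \<open>The box has at least twice as many points as \<open>A\<close>, so after
    Cauchy-Schwarz the correlation term is at most half of the left-hand side and is absorbed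
    there.\<close>
  have "2 * real (card A) \<le> card H" using L(1) H(2) of_nat_mono by fastforce
  hence "2 * (real (card A) * mass v) \<le> card H * mass v"
    using mult_right_mono[OF _ mass_nonneg[of v], of "2 * real (card A)" "card H"] by simp
  with main have "card H * mass v \<le> card H * ((real CARD('n) * L)\<^sup>2 * dirichlet v)" by linarith
  moreover have "real (card H) > 0" using H(2) L(2) by simp
  ultimately show ?thesis using mult_le_cancel_left_pos by blast
qed

text \<open>A box of side about \<open>(2 * s) powr (1 / N)\<close> contains twice as many points as
  the support. The bound \<open>s\<close> need not be the exact cardinality, so that Chebyshev's
  inequality can supply it. In the constant 16, one factor 4 comes from rounding the side and one
  from \<open>2 powr (2 / N)\<close>.\<close>

lemma faber_krahn:
  fixes v :: "int ^ 'n \<Rightarrow> real"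
  assumes A: "finite A" "\<And>x. x \<notin> A \<Longrightarrow> v x = 0" and nonneg: "\<And>x. 0 \<le> v x"
    and s: "real (card A) \<le> s"
  shows "mass v \<le> 16 * (real CARD('n))\<^sup>2 * s powr (2 / CARD('n)) * dirichlet v"
proof (cases "A = {}")
  case True
  hence "v = (\<lambda>_. 0)" using A(2) by auto
  thus ?thesis by (simp add: mass_def dirichlet_nonneg)
next
  case False
  define N where "N = real CARD('n)"
  have "N \<ge> 1" by (simp add: N_def Suc_leI)
  have "card A > 0" using A(1) False by (simp add: card_gt_0_iff)
  hence "s \<ge> 1" using s by linarith
  define r where "r = (2 * s) powr (1 / N)"
  define L where "L = nat \<lceil>r\<rceil>"
  have "r \<ge> 1" unfolding r_def using \<open>s \<ge> 1\<close> \<open>N \<ge> 1\<close> by (intro ge_one_powr_ge_zero) auto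
  \<comment> \<open>Rounding up at most doubles \<open>r\<close> because \<open>r\<close> \<ge>
    1.\<close>
  have L: "r \<le> real L" "real L \<le> 2 * r" "L > 0" using \<open>r \<ge> 1\<close> unfolding L_def by linarith+
  have "real (2 * card A) \<le> 2 * s" using s by simp
  also have "\<dots> = r ^ CARD('n)"
    using \<open>s \<ge> 1\<close> \<open>r \<ge> 1\<close> by (simp add: r_def N_def powr_powr flip: powr_realpow)
  also have "\<dots> \<le> real L ^ CARD('n)" using L(1) \<open>r \<ge> 1\<close> by (intro power_mono) auto
  finally have "real (2 * card A) \<le> real (L ^ CARD('n))" by simp
  hence "2 * card A \<le> L ^ CARD('n)" by (simp only: of_nat_le_iff)
  hence "mass v \<le> (N * L)\<^sup>2 * dirichlet v"
    unfolding N_def by (intro mass_le_dirichlet_of_small_support[OF A nonneg]) (use L(3) in auto)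
  also have "(N * L)\<^sup>2 \<le> (N * (2 * r))\<^sup>2"
    using \<open>N \<ge> 1\<close> L(2) by (intro power_mono mult_left_mono) auto
  also have "\<dots> = 4 * N\<^sup>2 * r\<^sup>2" by (simp add: power2_eq_square)
  also have "r\<^sup>2 = 2 powr (2 / N) * s powr (2 / N)"
    using \<open>s \<ge> 1\<close> \<open>N \<ge> 1\<close> by (simp add: r_def powr_powr powr_mult flip: powr_realpow)
  also have "2 powr (2 / N) \<le> 2 powr 2"
    using \<open>N \<ge> 1\<close> by (intro powr_mono) (auto simp: field_simps)
  also have "(2 :: real) powr 2 = 4" by simp
  finally show ?thesis
    by (simp add: N_def mult_left_mono mult_right_mono dirichlet_nonneg)
qed

text \<open>The part of \<open>t\<close> lying between the heights 2^-(k+2) and 2^-(k+1). Values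
  from 2^-(k+1) on fill the slice completely, and consecutive slices telescope.\<close>

definition slice :: "nat \<Rightarrow> real \<Rightarrow> real" where
  "slice k t = min t (1 / 2 ^ (k + 1)) - min t (1 / 2 ^ (k + 2))"

lemma slice_alt: "slice k t = min t (2 * (1 / 2 ^ (k + 2))) - min t (1 / 2 ^ (k + 2))"
  by (simp add: slice_def)

lemma
  fixes s t :: real
  shows slice_nonneg: "0 \<le> slice k t"
    and slice_eq_0: "t \<le> 1 / 2 ^ (k + 2) \<Longrightarrow> slice k t = 0"
    and slice_eq: "1 / 2 ^ (k + 1) \<le> t \<Longrightarrow> slice k t = 1 / 2 ^ (k + 2)"
    and slice_mono: "s \<le> t \<Longrightarrow> slice k s \<le> slice k t"
    and abs_slice_diff_le: "\<bar>slice k t - slice k s\<bar> \<le> \<bar>t - s\<bar>"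
proof -
  define c :: real where "c = 1 / 2 ^ (k + 2)"
  have c: "c > 0" "1 / 2 ^ (k + 1) = 2 * c" by (simp_all add: c_def)
  have eq: "slice k r = min r (2 * c) - min r c" for r by (simp add: slice_alt c_def)
  show "0 \<le> slice k t" "t \<le> 1 / 2 ^ (k + 2) \<Longrightarrow> slice k t = 0"
    "1 / 2 ^ (k + 1) \<le> t \<Longrightarrow> slice k t = 1 / 2 ^ (k + 2)"
    "s \<le> t \<Longrightarrow> slice k s \<le> slice k t" "\<bar>slice k t - slice k s\<bar> \<le> \<bar>t - s\<bar>"
    unfolding eq c(2) c_def[symmetric] using c(1) by (simp_all add: min_def)
qed

text \<open>Slices are monotone, so for s \<le> t all differences are nonnegative and telescope to
  at most t - s. The sum of squares of nonnegative numbers is at most the square of their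
  sum.\<close>

lemma sum_slice_square_le:
  "(\<Sum>k<n. (slice k t - slice k s)\<^sup>2) \<le> (t - s)\<^sup>2"
proof (induction s t rule: linorder_wlog)
  case (le s t)
  let ?d = "\<lambda>k. slice k t - slice k s"
  have d: "0 \<le> ?d k" for k using slice_mono[OF le] by simp
  have tel: "(\<Sum>k<n. slice k r) = min r (1 / 2) - min r (1 / 2 ^ (n + 1))" for r
    unfolding slice_def using sum_lessThan_telescope'[of "\<lambda>k. min r (1 / 2 ^ (k + 1))" n] by simp
  have le_diff: "(\<Sum>k<n. ?d k) \<le> t - s"
    using le by (simp add: sum_subtractf tel min_def)
  have "(\<Sum>k<n. (?d k)\<^sup>2) \<le> (\<Sum>k<n. ?d k * (\<Sum>k<n. ?d k))"
    unfolding power2_eq_square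
    by (intro sum_mono mult_left_mono d member_le_sum) (auto intro: d)
  also have "\<dots> = (\<Sum>k<n. ?d k)\<^sup>2" by (simp add: power2_eq_square sum_distrib_right)
  also have "\<dots> \<le> (t - s)\<^sup>2" by (intro power_mono le_diff sum_nonneg d)
  finally show ?case .
next
  case (sym s t)
  thus ?case by (simp add: power2_commute)
qed

lemma sum_dirichlet_slice_le:
  assumes u: "u \<in> lp 2"
  shows "(\<Sum>k<n. dirichlet (\<lambda>x. slice k (u x))) \<le> dirichlet u"
proof -
  have "(\<Sum>k<n. mass (increment e (\<lambda>x. slice k (u x)))) \<le> mass (increment e u)" for e
  proof (rule has_sum_mono)
    have "(\<lambda>x. slice k (u x)) \<in> lp 2" for k
      by (rule lp2_mono[OF u]) (use abs_slice_diff_le[of k _ 0] in \<open>simp add: slice_def\<close>)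
    thus "((\<lambda>x. \<Sum>k<n. (increment e (\<lambda>x. slice k (u x)) x)\<^sup>2) has_sum
        (\<Sum>k<n. mass (increment e (\<lambda>x. slice k (u x))))) UNIV"
      by (induction n) (auto intro!: has_sum_add lp2_has_sum lp2_increment)
    show "((\<lambda>x. (increment e u x)\<^sup>2) has_sum mass (increment e u)) UNIV"
      by (intro lp2_has_sum lp2_increment u)
  qed (simp add: increment_def sum_slice_square_le)
  thus ?thesis unfolding dirichlet_def by (subst sum.swap) (intro sum_mono)
qed

text \<open>Chebyshev's inequality, proved for finite subsets first: the uniform bound on their size
  gives finiteness of the whole level set.\<close>

lemma
  assumes u: "u \<in> lp 2" and "t > 0"
  shows finite_superlevel: "finite {x. u x > t}"
    and card_superlevel_le: "real (card {x. u x > t}) \<le> mass u / t\<^sup>2"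
proof -
  have bound: "real (card X) \<le> mass u / t\<^sup>2" if X: "X \<subseteq> {x. u x > t}" "finite X" for X
  proof -
    have "real (card X) * t\<^sup>2 = (\<Sum>x\<in>X. t\<^sup>2)" by simp
    also have "\<dots> \<le> (\<Sum>x\<in>X. (u x)\<^sup>2)" using X \<open>t > 0\<close> by (intro sum_mono power_mono) auto
    also have "\<dots> \<le> mass u" by (rule sum_le_mass[OF u X(2)])
    finally show ?thesis using \<open>t > 0\<close> by (simp add: field_simps)
  qed
  hence "card X \<le> nat \<lceil>mass u / t\<^sup>2\<rceil>" if "X \<subseteq> {x. u x > t}" "finite X" for X
    using bound[OF that] by linarith
  thus "finite {x. u x > t}" by (intro finite_if_finite_subsets_card_bdd[THEN conjunct1]) auto
  with bound show "real (card {x. u x > t}) \<le> mass u / t\<^sup>2" by blast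
qed

lemma dyadic_scale_exists:
  assumes "0 < t" "t \<le> (1 :: real)"
  shows "\<exists>k. 1 / 2 ^ (k + 1) \<le> t \<and> t \<le> 1 / 2 ^ k"
proof -
  have ex: "\<exists>k. 1 / 2 ^ (k + 1) \<le> t"
  proof -
    obtain k where "(1 / 2) ^ k < t" using real_arch_pow_inv[OF assms(1), of "1 / 2"] by auto
    moreover have "(1 :: real) / 2 ^ (k + 1) \<le> (1 / 2) ^ k" by (simp add: power_divide field_simps)
    ultimately show ?thesis by (intro exI[of _ k]) linarith
  qed
  define k where "k = (LEAST k. 1 / 2 ^ (k + 1) \<le> t)"
  have "1 / 2 ^ (k + 1) \<le> t" unfolding k_def by (rule LeastI_ex[OF ex])
  moreover have "t \<le> 1 / 2 ^ k"
  proof (cases k)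
    case (Suc j)
    hence "\<not> 1 / 2 ^ (j + 1) \<le> t" using not_less_Least[of j "\<lambda>k. 1 / 2 ^ (k + 1) \<le> t"] by (simp add: k_def)
    thus ?thesis by (simp add: Suc)
  qed (use assms in simp)
  ultimately show ?thesis by blast
qed

text \<open>The dyadic slices of \<open>u\<close> share out the Dirichlet energy, and the Faber--Krahn inequality applied
  to each of them bounds the number of points at the corresponding height.\<close>

lemma gagliardo_nirenberg_nonneg:
  fixes u :: "int ^ 'n \<Rightarrow> real"
  defines "p \<equiv> 2 + 4 / real CARD('n)"
  assumes u: "u \<in> lp 2" and nonneg: "\<And>x. 0 \<le> u x" and le1: "\<And>x. u x \<le> 1" and "finite X"
  shows "(\<Sum>x\<in>X. u x powr p)
    \<le> 4 powr p * (16 * (real CARD('n))\<^sup>2) * mass u powr (2 / CARD('n)) * dirichlet u"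
proof -
  define N where "N = real CARD('n)"
  have "N \<ge> 1" by (simp add: N_def Suc_leI)
  define a :: "nat \<Rightarrow> real" where "a k = 1 / 2 ^ (k + 2)" for k
  define G where "G = 4 powr p * (16 * N\<^sup>2) * mass u powr (2 / N)"
  have "G \<ge> 0" by (simp add: G_def)
  have a_pos: "a k > 0" for k by (simp add: a_def)
  \<comment> \<open>Zeros have no dyadic height and contribute nothing.\<close>
  define Y where "Y = {x \<in> X. u x > 0}"
  have "finite Y" using \<open>finite X\<close> by (simp add: Y_def)
  have "\<exists>k. 1 / 2 ^ (k + 1) \<le> u x \<and> u x \<le> 1 / 2 ^ k" if "x \<in> Y" for x
    using dyadic_scale_exists le1 that by (auto simp: Y_def)
  then obtain \<kappa> where \<kappa>: "\<And>x. x \<in> Y \<Longrightarrow> 1 / 2 ^ (\<kappa> x + 1) \<le> u x" "\<And>x. x \<in> Y \<Longrightarrow> u x \<le> 1 / 2 ^ \<kappa> x"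
    by metis
  have level: "(\<Sum>x | x \<in> Y \<and> \<kappa> x = k. u x powr p) \<le> G * dirichlet (\<lambda>x. slice k (u x))" for k
  proof -
    let ?D = "{x \<in> Y. \<kappa> x = k}" and ?v = "\<lambda>x. slice k (u x)"
    have fin: "finite ?D" using \<open>finite Y\<close> by simp
    have v: "?v \<in> lp 2"
      by (rule lp2_mono[OF u]) (use abs_slice_diff_le[of k _ 0] in \<open>simp add: slice_def\<close>)
    have "real (card ?D) * (a k)\<^sup>2 = (\<Sum>x\<in>?D. (?v x)\<^sup>2)"
    proof -
      have "?v x = a k" if "x \<in> ?D" for x
        unfolding a_def by (rule slice_eq) (use \<kappa>(1)[of x] that in auto)
      thus ?thesis by simp
    qed
    also have "\<dots> \<le> mass ?v" by (rule sum_le_mass[OF v fin])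
    also have "\<dots> \<le> 16 * N\<^sup>2 * (mass u / (a k)\<^sup>2) powr (2 / N) * dirichlet ?v"
      unfolding N_def
    proof (rule faber_krahn)
      show "finite {x. u x > a k}" by (rule finite_superlevel[OF u a_pos])
      show "real (card {x. u x > a k}) \<le> mass u / (a k)\<^sup>2" by (rule card_superlevel_le[OF u a_pos])
      show "?v x = 0" if "x \<notin> {x. u x > a k}" for x using that by (intro slice_eq_0) (simp add: a_def)
    qed (rule slice_nonneg)
    also have "(mass u / (a k)\<^sup>2) powr (2 / N) = mass u powr (2 / N) / a k powr (4 / N)"
    proof -
      have "(mass u / (a k)\<^sup>2) powr (2 / N) = mass u powr (2 / N) / ((a k)\<^sup>2) powr (2 / N)"
        by (rule powr_divide)
      also have "(a k)\<^sup>2 = a k powr 2" using a_pos[of k] by simp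
      also have "(a k powr 2) powr (2 / N) = a k powr (4 / N)" by (simp add: powr_powr)
      finally show ?thesis using a_pos[of k] by simp
    qed
    finally have "real (card ?D) * (a k)\<^sup>2 * a k powr (4 / N) \<le> 16 * N\<^sup>2 * mass u powr (2 / N) * dirichlet ?v"
      using a_pos[of k] by (simp add: field_simps)
    \<comment> \<open>The height from the lower bound on the mass of the slice and the height from
      Chebyshev's inequality combine to \<open>a k powr p\<close>; this is what determines the
      exponent \<open>p\<close>.\<close>
    moreover have "(a k)\<^sup>2 * a k powr (4 / N) = a k powr p"
      using a_pos[of k] by (simp add: p_def N_def powr_add)
    ultimately have card_le: "real (card ?D) * a k powr p \<le> 16 * N\<^sup>2 * mass u powr (2 / N) * dirichlet ?v"
      by (simp add: mult.assoc)
    \<comment> \<open>On this level \<open>u\<close> is at most 2^-k, which is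
      \<open>4 * a k\<close>.\<close>
    have "(\<Sum>x\<in>?D. u x powr p) \<le> (\<Sum>x\<in>?D. (4 * a k) powr p)"
      using \<kappa>(2) nonneg \<open>N \<ge> 1\<close> by (intro sum_mono powr_mono2) (auto simp: a_def p_def N_def)
    also have "\<dots> = 4 powr p * (real (card ?D) * a k powr p)"
      using a_pos[of k] by (simp add: powr_mult)
    also have "\<dots> \<le> 4 powr p * (16 * N\<^sup>2 * mass u powr (2 / N) * dirichlet ?v)"
      by (intro mult_left_mono card_le) simp
    finally show ?thesis by (simp add: G_def mult.assoc)
  qed
  obtain n where n: "\<kappa> ` Y \<subseteq> {..<n}"
    using finite_nat_iff_bounded[of "\<kappa> ` Y"] \<open>finite Y\<close> by auto
  have "(\<Sum>x\<in>X. u x powr p) = (\<Sum>x\<in>Y. u x powr p)"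
    using \<open>finite X\<close> nonneg by (intro sum.mono_neutral_right) (auto simp: Y_def not_less order_antisym)
  also have "\<dots> = (\<Sum>k\<in>\<kappa> ` Y. \<Sum>x | x \<in> Y \<and> \<kappa> x = k. u x powr p)"
    by (rule sum.image_gen[OF \<open>finite Y\<close>])
  also have "\<dots> \<le> (\<Sum>k\<in>\<kappa> ` Y. G * dirichlet (\<lambda>x. slice k (u x)))"
    by (intro sum_mono level)
  also have "\<dots> \<le> (\<Sum>k<n. G * dirichlet (\<lambda>x. slice k (u x)))"
    using n \<open>G \<ge> 0\<close> by (intro sum_mono2) (auto simp: dirichlet_nonneg)
  also have "\<dots> = G * (\<Sum>k<n. dirichlet (\<lambda>x. slice k (u x)))" by (simp add: sum_distrib_left)
  also have "\<dots> \<le> G * dirichlet u"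
    using \<open>G \<ge> 0\<close> by (intro mult_left_mono sum_dirichlet_slice_le u)
  finally show ?thesis by (simp add: G_def N_def)
qed

section \<open>Positivity of the threshold under the growth condition\<close>

lemma
  assumes "u \<in> lp 2"
  shows lp2_abs: "(\<lambda>x. \<bar>u x\<bar>) \<in> lp 2" and mass_abs: "mass (\<lambda>x. \<bar>u x\<bar>) = mass u"
    and dirichlet_abs_le: "dirichlet (\<lambda>x. \<bar>u x\<bar>) \<le> dirichlet u"
  using assms by (auto simp: lp2_iff mass_def intro!: dirichlet_contract abs_triangle_ineq3)

context potential
begin

lemma threshold_pos:
  assumes th: "is_threshold TYPE('n::finite) F ms"
    and limsup: "Limsup (at 0) (\<lambda>t. ereal (F t / \<bar>t\<bar> powr (2 + 4 / real CARD('n)))) < \<infinity>"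
  shows "0 < ms"
proof -
  define N where "N = real CARD('n)"
  have "N \<ge> 1" by (simp add: N_def Suc_leI)
  define p where "p = 2 + 4 / N"
  obtain c where c: "Limsup (at 0) (\<lambda>t. ereal (F t / \<bar>t\<bar> powr p)) < c" "c < \<infinity>"
    using dense[OF limsup] by (auto simp: p_def N_def)
  then obtain C0 where C0: "c = ereal C0" by (cases c) auto
  define C where "C = max C0 0"
  have "\<forall>\<^sub>F t in at 0. ereal (F t / \<bar>t\<bar> powr p) < ereal C0"
    using Limsup_lessD[OF c(1)] by (simp add: C0)
  then obtain d where d: "d > 0" "\<And>t. t \<noteq> 0 \<Longrightarrow> \<bar>t\<bar> < d \<Longrightarrow> F t / \<bar>t\<bar> powr p < C0"
    unfolding eventually_at by (auto simp: dist_real_def)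
  have F_le: "F t \<le> C * \<bar>t\<bar> powr p" if "\<bar>t\<bar> < d" for t
  proof (cases "t = 0")
    case False
    hence "F t / \<bar>t\<bar> powr p \<le> C" using d(2)[OF _ that] by (simp add: C_def)
    thus ?thesis using False by (simp add: field_simps)
  qed (simp add: F_0)
  define G where "G = 4 powr p * (16 * N\<^sup>2)"
  have "C \<ge> 0" "G \<ge> 0" by (simp_all add: C_def G_def)
  \<comment> \<open>Chosen so that the factor \<open>C * G * y\<close> in front of the Dirichlet
    energy does not exceed the 1/4 of the kinetic term.\<close>
  define y where "y = 1 / (4 * C * G + 1)"
  have y: "y > 0" "C * G * y \<le> 1 / 4"
    using \<open>C \<ge> 0\<close> \<open>G \<ge> 0\<close> by (simp_all add: y_def field_simps add_pos_nonneg)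
  \<comment> \<open>The bound 1 gives \<open>\<bar>u x\<bar>\<close> \<le> 1 as the dyadic argument
    requires, \<open>d\<^sup>2 / 4\<close> keeps the values where the growth bound on
    \<open>F\<close> holds, and the last bound makes \<open>m powr (2 / N)\<close> at most
    \<open>y\<close>.\<close>
  define m where "m = min 1 (min (d\<^sup>2 / 4) (y powr (N / 2)))"
  have m: "m > 0" "m \<le> 1" "m \<le> d\<^sup>2 / 4" "m \<le> y powr (N / 2)" using d(1) y(1) by (auto simp: m_def)
  have m_powr: "m powr (2 / N) \<le> y"
  proof -
    have "m powr (2 / N) \<le> (y powr (N / 2)) powr (2 / N)"
      using m \<open>N \<ge> 1\<close> by (intro powr_mono2) auto
    also have "\<dots> = y" using y(1) \<open>N \<ge> 1\<close> by (simp add: powr_powr)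
    finally show ?thesis .
  qed
  have sqrt_m: "sqrt m < d"
  proof -
    have "sqrt m \<le> sqrt ((d / 2)\<^sup>2)" using m(3) by (intro real_sqrt_le_mono) (simp add: power_divide)
    thus ?thesis using d(1) by simp
  qed
  have "0 \<le> energy F u" if u: "u \<in> lp 2" "mass u = m" for u :: "int ^ 'n \<Rightarrow> real"
  proof -
    have bd: "\<bar>u x\<bar> \<le> sqrt m" for x using abs_le_sqrt_mass[OF u(1), of m] u(2) by simp
    have "(\<Sum>\<^sub>\<infinity>x. F (u x)) \<le> 1/4 * dirichlet u"
    proof (rule infsum_le_finite_sums[OF F_summable[OF u(1)]])
      fix X :: "(int ^ 'n) set" assume X: "finite X"
      have "(\<Sum>x\<in>X. F (u x)) \<le> (\<Sum>x\<in>X. C * \<bar>u x\<bar> powr p)"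
        using bd sqrt_m by (intro sum_mono F_le) (auto intro: le_less_trans)
      also have "\<dots> = C * (\<Sum>x\<in>X. \<bar>u x\<bar> powr p)" by (simp add: sum_distrib_left)
      also have "(\<Sum>x\<in>X. \<bar>u x\<bar> powr p) \<le> G * mass (\<lambda>x. \<bar>u x\<bar>) powr (2 / N) * dirichlet (\<lambda>x. \<bar>u x\<bar>)"
        unfolding G_def p_def N_def
      proof (rule gagliardo_nirenberg_nonneg[OF lp2_abs[OF u(1)] _ _ X])
        show "\<bar>u x\<bar> \<le> 1" for x using bd[of x] m(2) real_sqrt_le_1_iff[of m] by linarith
      qed simp
      also have "\<dots> \<le> G * m powr (2 / N) * dirichlet u"
        unfolding mass_abs[OF u(1)] u(2) using \<open>G \<ge> 0\<close>
        by (intro mult_left_mono dirichlet_abs_le u(1)) auto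
      also have "C * (G * m powr (2 / N) * dirichlet u) = (C * G * m powr (2 / N)) * dirichlet u" by simp
      also have "C * G * m powr (2 / N) \<le> C * G * y"
        using \<open>C \<ge> 0\<close> \<open>G \<ge> 0\<close> by (intro mult_left_mono m_powr) auto
      also note y(2)
      finally show "(\<Sum>x\<in>X. F (u x)) \<le> 1/4 * dirichlet u"
        using \<open>C \<ge> 0\<close> by (simp add: mult_left_mono mult_right_mono dirichlet_nonneg)
    qed
    thus ?thesis by (simp add: energy_eq[OF u(1)])
  qed
  hence "0 \<le> min_energy TYPE('n) F m" using m(1) by (intro min_energy_geI) auto
  hence "\<not> ms < ereal m" using threshold_cases(2)[OF th m(1)] by linarith
  thus ?thesis using m(1) less_le_trans[of 0 "ereal m" ms] by (simp add: zero_ereal_def)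
qed

end


section \<open>Minimisers\<close>

lemma mass_add_finite_support:
  assumes p: "p \<in> lp 2" and A: "finite A" "\<And>x. x \<notin> A \<Longrightarrow> d x = 0"
  shows "mass (\<lambda>x. p x + d x) = mass p + (\<Sum>x\<in>A. 2 * p x * d x + (d x)\<^sup>2)"
proof -
  have "((\<lambda>x. 2 * p x * d x + (d x)\<^sup>2) has_sum (\<Sum>x\<in>A. 2 * p x * d x + (d x)\<^sup>2)) UNIV"
    by (rule has_sum_cong_neutral[THEN iffD1, OF _ _ _ has_sum_finite[OF A(1)]]) (use A(2) in auto)
  from has_sum_add[OF lp2_has_sum[OF p] this]
  have "((\<lambda>x. (p x + d x)\<^sup>2) has_sum (mass p + (\<Sum>x\<in>A. 2 * p x * d x + (d x)\<^sup>2))) UNIV"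
    by (simp add: power2_sum algebra_simps)
  thus ?thesis by (simp add: mass_def infsumI)
qed

text \<open>Raising \<open>w\<close> at a zero next to a point where it is positive lowers the energy to first order.\<close>

lemma dirichlet_fun_upd_le:
  fixes w :: "int ^ 'n \<Rightarrow> real"
  assumes w: "w \<in> lp 2" "\<And>x. 0 \<le> w x" and z: "w z = 0" and e0: "adj 0 e0" and "\<epsilon> \<ge> 0"
  shows "dirichlet (w(z := \<epsilon>))
    \<le> dirichlet w - 2 * \<epsilon> * w (z + e0) + 2 * real (card {e :: int ^ 'n. adj 0 e}) * \<epsilon>\<^sup>2"
proof -
  have incr: "mass (increment e (w(z := \<epsilon>))) = mass (increment e w) - 2 * \<epsilon> * (w (z + e) + w (z - e)) + 2 * \<epsilon>\<^sup>2"
    if e: "adj 0 e" for e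
  proof -
    have "e \<noteq> 0" using e by (auto simp: adj_def)
    define d where "d x = (if x + e = z then \<epsilon> else 0) - (if x = z then \<epsilon> else 0)" for x
    have "increment e (w(z := \<epsilon>)) = (\<lambda>x. increment e w x + d x)"
      using z \<open>e \<noteq> 0\<close> by (auto simp: increment_def d_def fun_eq_iff)
    moreover have "mass (\<lambda>x. increment e w x + d x)
        = mass (increment e w) + (\<Sum>x\<in>{z, z - e}. 2 * increment e w x * d x + (d x)\<^sup>2)"
    proof (rule mass_add_finite_support)
      show "d x = 0" if "x \<notin> {z, z - e}" for x using that by (auto simp: d_def)
    qed (use w(1) lp2_increment in auto)
    moreover have "(\<Sum>x\<in>{z, z - e}. 2 * increment e w x * d x + (d x)\<^sup>2)
        = - 2 * \<epsilon> * (w (z + e) + w (z - e)) + 2 * \<epsilon>\<^sup>2"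
    proof -
      have "z \<noteq> z - e" "d z = - \<epsilon>" "d (z - e) = \<epsilon>" using \<open>e \<noteq> 0\<close> by (auto simp: d_def)
      thus ?thesis by (simp add: increment_def z algebra_simps)
    qed
    ultimately show ?thesis by simp
  qed
  let ?D = "{e :: int ^ 'n. adj 0 e}"
  have "dirichlet (w(z := \<epsilon>))
      = (\<Sum>e\<in>?D. mass (increment e w) - 2 * \<epsilon> * (w (z + e) + w (z - e)) + 2 * \<epsilon>\<^sup>2)"
    unfolding dirichlet_def by (intro sum.cong refl incr) simp
  also have "\<dots> = dirichlet w - 2 * \<epsilon> * (\<Sum>e\<in>?D. w (z + e) + w (z - e)) + real (card ?D) * (2 * \<epsilon>\<^sup>2)"
    unfolding dirichlet_def sum.distrib sum_subtractf by (simp add: sum.distrib flip: sum_distrib_left)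
  \<comment> \<open>All neighbours enter with the favourable sign, so the direction
    \<open>e0\<close> alone may be kept.\<close>
  also have "w (z + e0) + w (z - e0) \<le> (\<Sum>e\<in>?D. w (z + e) + w (z - e))"
    by (rule member_le_sum) (use e0 w(2) finite_adj in auto)
  hence "w (z + e0) \<le> (\<Sum>e\<in>?D. w (z + e) + w (z - e))" using w(2)[of "z - e0"] by linarith
  hence "2 * \<epsilon> * w (z + e0) \<le> 2 * \<epsilon> * (\<Sum>e\<in>?D. w (z + e) + w (z - e))"
    using \<open>\<epsilon> \<ge> 0\<close> by (intro mult_left_mono) auto
  hence "dirichlet w - 2 * \<epsilon> * (\<Sum>e\<in>?D. w (z + e) + w (z - e)) + real (card ?D) * (2 * \<epsilon>\<^sup>2)
      \<le> dirichlet w - 2 * \<epsilon> * w (z + e0) + 2 * real (card ?D) * \<epsilon>\<^sup>2" by simp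
  finally show ?thesis .
qed

text \<open>The lattice is connected: if every neighbour of a zero were a zero, induction on the
  distance from \<open>z\<close> would make \<open>w\<close> vanish everywhere.\<close>

lemma exists_boundary_point:
  fixes w :: "int ^ 'n \<Rightarrow> real"
  assumes "w z = 0" "w y \<noteq> 0"
  shows "\<exists>x e. adj 0 e \<and> w x = 0 \<and> w (x + e) \<noteq> 0"
proof (rule ccontr)
  assume "\<nexists>x e. adj 0 e \<and> w x = 0 \<and> w (x + e) \<noteq> 0"
  hence step: "w (x + e) = 0" if "w x = 0" "adj 0 e" for x e using that by blast
  have "w (z + h) = 0" if "ell1 h = int n" for h n using that
  proof (induction n arbitrary: h)
    case 0
    thus ?case using assms(1) ell1_eq_0_iff[of h] by simp
  next
    case (Suc n)
    hence "h \<noteq> 0" using ell1_eq_0_iff[of h] by auto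
    then obtain i s where s: "s \<in> {1, -1}" and l: "ell1 (h - axis i s) = ell1 h - 1"
      using ell1_step by blast
    have "w (z + (h - axis i s)) = 0" using Suc l by simp
    moreover have "adj 0 (axis i s :: int ^ 'n)" using s by (auto simp: adj_0_iff ell1_axis)
    ultimately have "w (z + (h - axis i s) + axis i s) = 0" by (rule step)
    thus ?case by (simp add: algebra_simps)
  qed
  from this[of "y - z" "nat (ell1 (y - z))"] show False using assms(2) by (simp add: ell1_nonneg)
qed

context potential
begin

text \<open>At a zero with a positive neighbour, raising the value to \<epsilon> lowers the energy
  by order \<epsilon>, while the mass grows by \<open>\<epsilon>\<^sup>2\<close> only. Since the
  minimal energy is locally Lipschitz in the mass, this contradicts minimality for small
  \<epsilon>.\<close>

lemma minimiser_pos: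
  fixes w :: "int ^ 'n \<Rightarrow> real"
  assumes w: "w \<in> lp 2" "\<And>x. 0 \<le> w x" "mass w = m" "0 < m"
    and min: "energy F w = min_energy TYPE('n) F m"
  shows "0 < w z"
proof (rule ccontr)
  let ?E = "min_energy TYPE('n) F"
  assume "\<not> 0 < w z"
  hence "w z = 0" using w(2)[of z] by linarith
  moreover obtain y where "w y \<noteq> 0" using w mass_eq_0_iff[OF w(1)] by (auto simp: fun_eq_iff)
  ultimately obtain x e where e: "adj 0 e" and x: "w x = 0" "w (x + e) \<noteq> 0"
    using exists_boundary_point by blast
  define c where "c = w (x + e)"
  have "c > 0" using x(2) w(2)[of "x + e"] by (simp add: c_def)
  define k where "k = real (card {e :: int ^ 'n. adj 0 e})"
  obtain K where K: "K > 0" "\<And>a b. 0 < a \<Longrightarrow> a \<le> m + 1 \<Longrightarrow> 0 < b \<Longrightarrow> b \<le> m + 1 \<Longrightarrow>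
      ?E b \<le> ?E a + K * \<bar>b - a\<bar> * ((2 * a + b) / a)"
    using min_energy_scale[where 'n = 'n and m = "m + 1"] by blast
  obtain \<rho> where \<rho>: "\<rho> > 0" "\<And>t. \<bar>t\<bar> \<le> \<rho> \<Longrightarrow> \<bar>F t\<bar> \<le> 1 * t\<^sup>2" using F_small[of 1] by auto
  \<comment> \<open>Collects the costs of second order: \<open>k / 2\<close> from the Dirichlet
    energy, 1 from \<open>F\<close>, and \<open>3 * K\<close> from the change of mass. The bound
    \<open>c / (4 * Q)\<close> on \<epsilon> then keeps them below the gain
    \<open>\<epsilon> * c / 2\<close>.\<close>
  define Q where "Q = k / 2 + 1 + 3 * K"
  have "Q > 0" using K(1) by (simp add: Q_def k_def add_nonneg_pos)
  define \<epsilon> where "\<epsilon> = min 1 (min \<rho> (c / (4 * Q)))"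
  have \<epsilon>: "\<epsilon> > 0" "\<epsilon> \<le> 1" "\<epsilon> \<le> \<rho>" "\<epsilon> \<le> c / (4 * Q)"
    using \<rho>(1) \<open>c > 0\<close> \<open>Q > 0\<close> by (auto simp: \<epsilon>_def)
  define v where "v = w(x := \<epsilon>)"
  define d where "d y = (if y = x then \<epsilon> else 0)" for y
  have d: "d \<in> lp 2" unfolding d_def by (rule lp2_finite_support) simp
  have v_eq: "v = (\<lambda>y. w y + d y)" using x(1) by (auto simp: v_def d_def fun_eq_iff)
  have v: "v \<in> lp 2" unfolding v_eq by (intro lp2_add(1) w(1) d)
  have "mass v = m + (\<Sum>y\<in>{x}. 2 * w y * d y + (d y)\<^sup>2)"
    unfolding v_eq by (subst mass_add_finite_support[OF w(1), of "{x}"]) (auto simp: d_def w(3))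
  hence mv: "mass v = m + \<epsilon>\<^sup>2" using x(1) by (simp add: d_def)
  have "((\<lambda>y. F (w y) + F (d y)) has_sum (\<Sum>\<^sub>\<infinity>y. F (w y)) + F \<epsilon>) UNIV"
  proof (intro has_sum_add F_has_sum w(1))
    have "((\<lambda>y. F (d y)) has_sum (\<Sum>y\<in>{x}. F (d y))) UNIV"
      by (rule has_sum_cong_neutral[THEN iffD1, OF _ _ _ has_sum_finite[of "{x}"]]) (auto simp: d_def F_0)
    thus "((\<lambda>y. F (d y)) has_sum F \<epsilon>) UNIV" by (simp add: d_def)
  qed
  moreover have "F (w y) + F (d y) = F (v y)" for y using x(1) by (simp add: d_def v_def F_0)
  ultimately have "(\<Sum>\<^sub>\<infinity>y. F (v y)) = (\<Sum>\<^sub>\<infinity>y. F (w y)) + F \<epsilon>" by (simp add: infsumI)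
  moreover have "\<bar>F \<epsilon>\<bar> \<le> \<epsilon>\<^sup>2" using \<rho>(2)[of \<epsilon>] \<epsilon> by simp
  moreover have "dirichlet v \<le> dirichlet w - 2 * \<epsilon> * c + 2 * k * \<epsilon>\<^sup>2"
    unfolding v_def c_def k_def by (rule dirichlet_fun_upd_le[OF w(1,2) x(1) e]) (use \<epsilon>(1) in simp)
  ultimately have "energy F v \<le> energy F w - \<epsilon> * c / 2 + (k / 2 + 1) * \<epsilon>\<^sup>2"
    unfolding energy_eq[OF w(1)] energy_eq[OF v] distrib_right by linarith
  moreover have "?E (m + \<epsilon>\<^sup>2) \<le> energy F v" by (rule min_energy_le[OF v mv])
  \<comment> \<open>Monotonicity bounds the minimal energy in the other direction, so the comparison
    has to come from scaling back to mass \<open>m\<close>.\<close>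
  moreover have "?E m \<le> ?E (m + \<epsilon>\<^sup>2) + K * \<epsilon>\<^sup>2 * 3"
  proof -
    have "\<epsilon>\<^sup>2 \<le> 1" using \<epsilon> by (simp add: power_le_one)
    hence "?E m \<le> ?E (m + \<epsilon>\<^sup>2) + K * \<bar>m - (m + \<epsilon>\<^sup>2)\<bar> * ((2 * (m + \<epsilon>\<^sup>2) + m) / (m + \<epsilon>\<^sup>2))"
      using \<open>0 < m\<close> by (intro K(2)) (auto intro: add_pos_nonneg)
    also have "(2 * (m + \<epsilon>\<^sup>2) + m) / (m + \<epsilon>\<^sup>2) \<le> 3"
      using \<open>0 < m\<close> by (simp add: divide_le_eq add_pos_nonneg)
    finally show ?thesis using K(1) by (simp add: mult_left_mono)
  qed
  ultimately have "\<epsilon> * c / 2 \<le> (k / 2 + 1) * \<epsilon>\<^sup>2 + K * \<epsilon>\<^sup>2 * 3" using min by linarith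
  also have "\<dots> = \<epsilon> * (Q * \<epsilon>)" by (simp add: Q_def power2_eq_square algebra_simps)
  finally have "c / 2 \<le> Q * \<epsilon>" using \<epsilon>(1) by simp
  also have "\<dots> \<le> Q * (c / (4 * Q))" using \<epsilon>(4) \<open>Q > 0\<close> by (intro mult_left_mono) auto
  also have "\<dots> = c / 4" using \<open>Q > 0\<close> by simp
  finally show False using \<open>c > 0\<close> by simp
qed

end

text \<open>Brings the equimeasurability of rearrangements from [0, \<infinity>] to real sums.
  Summability of \<open>g\<close> is part of the conclusion.\<close>

lemma infsum_ennreal_eqD:
  fixes f g :: "'a \<Rightarrow> real"
  assumes f: "f summable_on UNIV" "\<And>x. 0 \<le> f x" and g: "\<And>x. 0 \<le> g x"
    and eq: "(\<Sum>\<^sub>\<infinity>x. ennreal (f x)) = (\<Sum>\<^sub>\<infinity>x. ennreal (g x))"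
  shows "(g has_sum (\<Sum>\<^sub>\<infinity>x. f x)) UNIV"
proof -
  have conv: "(\<Sum>\<^sub>\<infinity>x. ennreal (h x)) = ennreal (\<Sum>\<^sub>\<infinity>x. h x)"
    if "h summable_on UNIV" "\<And>x. 0 \<le> h x" for h :: "'a \<Rightarrow> real"
    using infsum_nonneg_is_SUPREMUM_ennreal[of h UNIV] that
      nonneg_infsum_complete[of UNIV "\<lambda>x. ennreal (h x)"]
    by (simp add: sum_ennreal)
  have "(\<Sum>x\<in>X. g x) \<le> (\<Sum>\<^sub>\<infinity>x. f x)" if "finite X" for X
  proof -
    have "ennreal (\<Sum>x\<in>X. g x) = (\<Sum>x\<in>X. ennreal (g x))" using g by (simp add: sum_ennreal)
    also have "\<dots> \<le> (\<Sum>\<^sub>\<infinity>x. ennreal (g x))" 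
      by (subst nonneg_infsum_complete) (auto intro!: SUP_upper that)
    also have "\<dots> = ennreal (\<Sum>\<^sub>\<infinity>x. f x)" using eq conv[OF f] by simp
    finally show ?thesis using f(2) by (simp add: infsum_nonneg)
  qed
  hence "g summable_on UNIV" using g by (intro nonneg_bdd_above_summable_on) (auto intro!: bdd_aboveI2)
  moreover from this have "(\<Sum>\<^sub>\<infinity>x. g x) = (\<Sum>\<^sub>\<infinity>x. f x)"
    using conv[OF f] conv[of g] eq f(2) g by (simp add: infsum_nonneg ennreal_inj)
  ultimately show ?thesis by (simp add: has_sum_iff)
qed

text \<open>Fatou's lemma for counting measure, by passing to the limit in finite partial sums. The
  bound may vary with \<open>k\<close> as long as it converges.\<close>

lemma has_sum_fatou:
  fixes g :: "nat \<Rightarrow> 'a \<Rightarrow> real"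
  assumes g: "\<And>k. (g k has_sum S k) UNIV" "\<And>k x. 0 \<le> g k x"
    and lim: "\<And>x. (\<lambda>k. g k x) \<longlonglongrightarrow> h x"
    and b: "\<forall>\<^sub>F k in sequentially. S k \<le> b k" "b \<longlonglongrightarrow> c"
  shows "h summable_on UNIV" "(\<Sum>\<^sub>\<infinity>x. h x) \<le> c"
proof -
  have nonneg: "0 \<le> h x" for x by (rule LIMSEQ_le_const[OF lim]) (use g(2) in blast)
  have bound: "(\<Sum>x\<in>X. h x) \<le> c" if X: "finite X" for X
  proof (rule tendsto_le[OF sequentially_bot b(2)])
    show "(\<lambda>k. \<Sum>x\<in>X. g k x) \<longlonglongrightarrow> (\<Sum>x\<in>X. h x)" by (intro tendsto_sum lim)
    show "\<forall>\<^sub>F k in sequentially. (\<Sum>x\<in>X. g k x) \<le> b k"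
      using b(1) by eventually_elim
        (rule order_trans[OF finite_sum_le_has_sum[OF g(1) X]], use g(2) in auto)
  qed
  show "h summable_on UNIV"
    using nonneg bound by (intro nonneg_bdd_above_summable_on) (auto intro!: bdd_aboveI2)
  thus "(\<Sum>\<^sub>\<infinity>x. h x) \<le> c" by (rule infsum_le_finite_sums) (use bound in auto)
qed

lemma has_sum_dirichlet:
  "u \<in> lp 2 \<Longrightarrow> ((\<lambda>x. \<Sum>e | adj 0 e. (increment e u x)\<^sup>2) has_sum dirichlet u) UNIV"
  unfolding dirichlet_def by (intro has_sum_finite_sum lp2_has_sum lp2_increment)

text \<open>The compactness property is used from exponent 2 to some larger one; 4 is convenient as
  an even integer, and convergence in this norm is already uniform by
  \<open>abs_le_lp4_norm\<close>.\<close>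

lemma lp4_iff: "u \<in> lp 4 \<longleftrightarrow> (\<lambda>x. (u x) ^ 4) summable_on UNIV"
  by (simp add: lp_def)

lemma lp2_imp_lp4:
  assumes "u \<in> lp 2"
  shows "u \<in> lp 4"
  unfolding lp4_iff
proof (rule summable_on_comparison_test)
  show "(\<lambda>x. mass u * (u x)\<^sup>2) summable_on UNIV"
    using assms by (intro summable_on_cmult_right) (simp add: lp2_iff)
  show "(u x) ^ 4 \<le> mass u * (u x)\<^sup>2" for x
    using mult_right_mono[OF square_le_mass[OF assms, of x], of "(u x)\<^sup>2"]
    by (simp flip: power_add)
qed simp

lemma abs_le_lp4_norm:
  assumes "u \<in> lp 4"
  shows "\<bar>u x\<bar> \<le> lp_norm 4 u"
proof -
  have "(\<Sum>y\<in>{x}. \<bar>u y\<bar> powr 4) \<le> (\<Sum>\<^sub>\<infinity>y. \<bar>u y\<bar> powr 4)"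
    using assms by (intro finite_sum_le_infsum) (auto simp: lp_def)
  hence "(\<bar>u x\<bar> powr 4) powr (1 / 4) \<le> lp_norm 4 u"
    unfolding lp_norm_def by (intro powr_mono2) auto
  thus ?thesis by (simp add: powr_powr del: powr_numeral)
qed

lemma lp4_diff:
  assumes "u \<in> lp 4" "v \<in> lp 4"
  shows "(\<lambda>x. u x - v x) \<in> lp 4"
  unfolding lp4_iff
proof (rule summable_on_comparison_test)
  show "(\<lambda>x. 8 * (u x) ^ 4 + 8 * (v x) ^ 4) summable_on UNIV"
    using assms by (intro summable_on_add summable_on_cmult_right) (auto simp: lp4_iff)
  fix x
  have "(u x - v x) ^ 4 = ((u x - v x)\<^sup>2)\<^sup>2" by simp
  also have "\<dots> \<le> (2 * (u x)\<^sup>2 + 2 * (v x)\<^sup>2)\<^sup>2" by (intro power_mono square_diff_le) simp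
  also have "\<dots> \<le> 2 * (2 * (u x)\<^sup>2)\<^sup>2 + 2 * (2 * (v x)\<^sup>2)\<^sup>2" by (rule square_sum_le)
  finally show "(u x - v x) ^ 4 \<le> 8 * (u x) ^ 4 + 8 * (v x) ^ 4" by simp
qed simp

lemma lp_norm_2: "lp_norm 2 u = sqrt (mass u)"
  by (simp add: lp_norm_def mass_def powr_half_sqrt infsum_nonneg)

lemma lp_norm_grad: "u \<in> lp 2 \<Longrightarrow> lp_norm 2 (grad u) = sqrt (1/2 * dirichlet u)"
  using infsumI[OF has_sum_grad, of u] by (simp add: lp_norm_2 mass_def)

lemma admissible_lp2: "u \<in> lp 2 \<Longrightarrow> (\<And>x. 0 \<le> u x) \<Longrightarrow> admissible u"
  unfolding admissible_def using finite_superlevel by blast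

section \<open>Rearranged minimising sequences and their limits\<close>

context potential
begin

lemma F_tendsto:
  assumes "a \<longlonglongrightarrow> b"
  shows "(\<lambda>k :: nat. F (a k)) \<longlonglongrightarrow> F b"
proof -
  obtain C where C: "\<And>x y. \<bar>x\<bar> \<le> \<bar>b\<bar> + 1 \<Longrightarrow> \<bar>y\<bar> \<le> \<bar>b\<bar> + 1 \<Longrightarrow> \<bar>F x - F y\<bar> \<le> C * ((\<bar>x\<bar> + \<bar>y\<bar>) * \<bar>x - y\<bar>)"
    using F_lipschitz by blast
  have "\<forall>\<^sub>F k in sequentially. dist (a k) b < 1" using tendstoD[OF assms, of 1] by simp
  hence ev: "\<forall>\<^sub>F k in sequentially. \<bar>F (a k) - F b\<bar> \<le> C * ((\<bar>a k\<bar> + \<bar>b\<bar>) * \<bar>a k - b\<bar>)"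
    by eventually_elim (rule C, auto simp: dist_real_def)
  have "(\<lambda>k. C * ((\<bar>a k\<bar> + \<bar>b\<bar>) * \<bar>a k - b\<bar>)) \<longlonglongrightarrow> C * ((\<bar>b\<bar> + \<bar>b\<bar>) * \<bar>b - b\<bar>)"
    by (intro tendsto_intros assms)
  hence "(\<lambda>k. C * ((\<bar>a k\<bar> + \<bar>b\<bar>) * \<bar>a k - b\<bar>)) \<longlonglongrightarrow> 0" by simp
  hence "(\<lambda>k. F (a k) - F b) \<longlonglongrightarrow> 0" by (rule Lim_null_comparison[rotated]) (use ev in simp)
  thus ?thesis by (simp add: LIM_zero_cancel)
qed

text \<open>The quotient \<open>F t / t\<^sup>2\<close> is non-decreasing and has limit 0 at the
  origin by \<open>F_small\<close>. Nonnegativity lets \<open>F\<close> serve as the function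
  \<open>g\<close> in \<open>equimeasurable\<close>.\<close>

lemma F_nonneg:
  assumes mono: "mono_on {0<..} (\<lambda>t. F t / t\<^sup>2)" and "0 \<le> t"
  shows "0 \<le> F t"
proof (cases "t = 0")
  case False
  hence "t > 0" using assms by simp
  have "0 \<le> F t / t\<^sup>2"
  proof (rule field_le_epsilon)
    fix \<eta> :: real assume "\<eta> > 0"
    then obtain \<rho> where \<rho>: "\<rho> > 0" "\<And>s. \<bar>s\<bar> \<le> \<rho> \<Longrightarrow> \<bar>F s\<bar> \<le> \<eta> * s\<^sup>2" using F_small by blast
    define s where "s = min \<rho> t"
    have s: "0 < s" "s \<le> t" "s \<le> \<rho>" using \<rho>(1) \<open>t > 0\<close> by (auto simp: s_def)
    have "- \<eta> * s\<^sup>2 \<le> F s" using \<rho>(2)[of s] s by (simp add: abs_le_iff)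
    hence "- \<eta> \<le> F s / s\<^sup>2" using s(1) by (simp add: pos_le_divide_eq)
    also have "\<dots> \<le> F t / t\<^sup>2" using mono_onD[OF mono, of s t] s by simp
    finally show "0 \<le> F t / t\<^sup>2 + \<eta>" by simp
  qed
  thus ?thesis using \<open>t > 0\<close> by (simp add: zero_le_divide_iff)
qed (simp add: F_0)

lemma F_scale:
  assumes mono: "mono_on {0<..} (\<lambda>t. F t / t\<^sup>2)" and "0 \<le> s" "1 \<le> t"
  shows "t\<^sup>2 * F s \<le> F (t * s)"
proof (cases "s = 0")
  case False
  hence "F s / s\<^sup>2 \<le> F (t * s) / (t * s)\<^sup>2"
    using mono_onD[OF mono, of s "t * s"] assms by simp
  thus ?thesis using False \<open>1 \<le> t\<close> by (simp add: field_simps power_mult_distrib)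
qed (simp add: F_0)

text \<open>Passing to the absolute value raises the potential sum and does not raise the Dirichlet
  energy. The rearrangement then keeps the mass and the potential sum, and does not raise the
  Dirichlet energy by \<open>polya_szego\<close>.\<close>

lemma rearrangement:
  fixes R :: "(int ^ 'n \<Rightarrow> real) \<Rightarrow> int ^ 'n \<Rightarrow> real" and u :: "int ^ 'n \<Rightarrow> real"
  assumes R: "schwarz_rearrangement R"
    and mono: "mono_on {0<..} (\<lambda>t. F t / t\<^sup>2)" and abs: "\<And>t. F t \<le> F \<bar>t\<bar>"
    and u: "u \<in> lp 2"
  shows "\<exists>v. schwarz_symmetric R v \<and> v \<in> lp 2 \<and> mass v = mass u \<and> energy F v \<le> energy F u"
proof -
  interpret schwarz_rearrangement R by (rule R)
  define w where "w x = \<bar>u x\<bar>" for x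
  have w: "w \<in> lp 2" "mass w = mass u" "dirichlet w \<le> dirichlet u" "\<And>x. 0 \<le> w x"
    unfolding w_def using lp2_abs[OF u] mass_abs[OF u] dirichlet_abs_le[OF u] by auto
  have adm: "admissible w" by (rule admissible_lp2[OF w(1,4)])
  define v where "v = R w"
  have sym: "schwarz_symmetric R v"
    unfolding schwarz_symmetric_def v_def using closed[OF adm] idempotent[OF adm] by simp
  have v0: "0 \<le> v x" for x using closed[OF adm] by (simp add: admissible_def v_def)
  have "((\<lambda>x. (v x)\<^sup>2) has_sum (\<Sum>\<^sub>\<infinity>x. (w x)\<^sup>2)) UNIV"
    using w(1) equimeasurable[of "\<lambda>t. t\<^sup>2", OF _ _ adm]
    by (intro infsum_ennreal_eqD) (auto simp: lp2_iff v_def)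
  hence v: "v \<in> lp 2" "mass v = mass u"
    using w(2) by (auto simp: lp2_iff mass_def has_sum_iff)
  have "((\<lambda>x. F (v x)) has_sum (\<Sum>\<^sub>\<infinity>x. F (w x))) UNIV"
    using equimeasurable[of F, OF _ F_0 adm] F_nonneg[OF mono] v0 w(4)
    by (intro infsum_ennreal_eqD F_summable w(1)) (auto simp: v_def)
  moreover have "(\<Sum>\<^sub>\<infinity>x. F (u x)) \<le> (\<Sum>\<^sub>\<infinity>x. F (w x))"
    by (intro infsum_mono F_summable u w(1)) (use abs in \<open>simp add: w_def\<close>)
  moreover have "dirichlet v \<le> dirichlet u"
    using polya_szego[OF w(1)] w(3,4) lp_norm_grad[OF w(1)] lp_norm_grad[OF v(1)] by (simp add: v_def)
  ultimately have "energy F v \<le> energy F u"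
    by (simp add: energy_eq u v(1) infsumI)
  with sym v show ?thesis by blast
qed

text \<open>By uniform convergence, all late \<open>v k\<close> are at most \<rho> in absolute value
  outside one finite set. There the potential contributes at most
  \<open>\<eta> * m = \<epsilon>\<close>, even if mass escapes. On the finite set pointwise
  convergence suffices, and the Dirichlet energies are handled by Fatou.\<close>

lemma energy_lower_semicontinuous:
  fixes v :: "nat \<Rightarrow> int ^ 'n \<Rightarrow> real"
  assumes F_nonneg: "\<And>t. 0 \<le> t \<Longrightarrow> 0 \<le> F t"
    and v: "\<And>k. v k \<in> lp 2" "\<And>k. mass (v k) = m" "m > 0" and w: "w \<in> lp 2" "\<And>x. 0 \<le> w x"
    and unif: "\<And>k x. \<bar>v k x - w x\<bar> \<le> d k" "d \<longlonglongrightarrow> 0"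
    and energy: "\<And>k. energy F (v k) \<le> b k" "b \<longlonglongrightarrow> E"
  shows "energy F w \<le> E"
proof (rule field_le_epsilon)
  fix \<epsilon> :: real assume "\<epsilon> > 0"
  have lim: "(\<lambda>k. v k x) \<longlonglongrightarrow> w x" for x
  proof -
    have "(\<lambda>k. v k x - w x) \<longlonglongrightarrow> 0" by (rule Lim_null_comparison[OF _ unif(2)]) (use unif(1) in simp)
    thus ?thesis by (rule LIM_zero_cancel)
  qed
  define \<eta> where "\<eta> = \<epsilon> / m"
  have "\<eta> > 0" "\<eta> * m = \<epsilon>" using \<open>\<epsilon> > 0\<close> \<open>m > 0\<close> by (simp_all add: \<eta>_def)
  obtain \<rho> where \<rho>: "\<rho> > 0" "\<And>t. \<bar>t\<bar> \<le> \<rho> \<Longrightarrow> \<bar>F t\<bar> \<le> \<eta> * t\<^sup>2" using F_small[OF \<open>\<eta> > 0\<close>] by blast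
  \<comment> \<open>Half of \<rho> is reserved for the distance between \<open>v k\<close> and
    \<open>w\<close>.\<close>
  define B where "B = {x. w x > \<rho> / 2}"
  have B: "finite B" unfolding B_def using \<rho>(1) by (intro finite_superlevel w(1)) simp
  have "\<forall>\<^sub>F k in sequentially. d k < \<rho> / 2" using order_tendstoD(2)[OF unif(2), of "\<rho> / 2"] \<rho>(1) by simp
  hence ev: "\<forall>\<^sub>F k in sequentially. dirichlet (v k) \<le> 4 * (b k + (\<Sum>x\<in>B. \<bar>F (v k x)\<bar>) + \<epsilon>)"
  proof eventually_elim
    case (elim k)
    have "(\<Sum>\<^sub>\<infinity>x. F (v k x)) \<le> (\<Sum>x\<in>B. \<bar>F (v k x)\<bar>) + \<eta> * mass (v k)"
    proof (rule has_sum_mono[OF F_has_sum[OF v(1)]])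
      have "((\<lambda>x. if x \<in> B then \<bar>F (v k x)\<bar> else 0) has_sum (\<Sum>x\<in>B. \<bar>F (v k x)\<bar>)) UNIV"
        by (rule has_sum_cong_neutral[THEN iffD1, OF _ _ _ has_sum_finite[OF B]]) auto
      thus "((\<lambda>x. (if x \<in> B then \<bar>F (v k x)\<bar> else 0) + \<eta> * (v k x)\<^sup>2) has_sum
          (\<Sum>x\<in>B. \<bar>F (v k x)\<bar>) + \<eta> * mass (v k)) UNIV"
        by (intro has_sum_add has_sum_cmult_right lp2_has_sum v(1))
      fix x
      show "F (v k x) \<le> (if x \<in> B then \<bar>F (v k x)\<bar> else 0) + \<eta> * (v k x)\<^sup>2"
      proof (cases "x \<in> B")
        case True
        have "0 \<le> \<eta> * (v k x)\<^sup>2" using \<open>\<eta> > 0\<close> by simp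
        thus ?thesis using True by simp
      next
        case False
        hence "\<bar>v k x\<bar> \<le> \<rho>" using unif(1)[of k x] w(2)[of x] elim by (simp add: B_def)
        thus ?thesis using \<rho>(2)[of "v k x"] False by (simp add: abs_le_iff)
      qed
    qed
    thus ?case using energy(1)[of k] v(2)[of k] \<open>\<eta> * m = \<epsilon>\<close> by (simp add: energy_eq v(1))
  qed
  have "(\<Sum>\<^sub>\<infinity>x. \<Sum>e | adj 0 e. (increment e w x)\<^sup>2) \<le> 4 * (E + (\<Sum>x\<in>B. \<bar>F (w x)\<bar>) + \<epsilon>)"
  proof (rule has_sum_fatou(2)[OF has_sum_dirichlet[OF v(1)] _ _ ev])
    show "(\<lambda>k. \<Sum>e | adj 0 e. (increment e (v k) x)\<^sup>2) \<longlonglongrightarrow> (\<Sum>e | adj 0 e. (increment e w x)\<^sup>2)" for x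
      unfolding increment_def by (intro tendsto_intros lim)
    show "(\<lambda>k. 4 * (b k + (\<Sum>x\<in>B. \<bar>F (v k x)\<bar>) + \<epsilon>)) \<longlonglongrightarrow> 4 * (E + (\<Sum>x\<in>B. \<bar>F (w x)\<bar>) + \<epsilon>)"
      by (intro tendsto_intros F_tendsto lim energy(2))
  qed (simp add: sum_nonneg)
  hence "dirichlet w \<le> 4 * (E + (\<Sum>x\<in>B. \<bar>F (w x)\<bar>) + \<epsilon>)"
    using infsumI[OF has_sum_dirichlet[OF w(1)]] by simp
  moreover have "(\<Sum>x\<in>B. \<bar>F (w x)\<bar>) = (\<Sum>x\<in>B. F (w x))" using F_nonneg w(2) by simp
  moreover have "\<dots> \<le> (\<Sum>\<^sub>\<infinity>x. F (w x))"
    using B F_nonneg w(2) by (intro finite_sum_le_infsum F_summable w(1)) auto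
  ultimately show "energy F w \<le> E + \<epsilon>" by (simp add: energy_eq w(1))
qed

lemma symmetric_minimiser_exists:
  fixes R :: "(int ^ 'n \<Rightarrow> real) \<Rightarrow> int ^ 'n \<Rightarrow> real"
  assumes th: "is_threshold TYPE('n) F ms" and R: "schwarz_rearrangement R"
    and mono: "mono_on {0<..} (\<lambda>t. F t / t\<^sup>2)" and abs: "\<And>t. F t \<le> F \<bar>t\<bar>"
    and m: "m > 0" "ms < ereal m"
  shows "\<exists>w \<in> lp 2. mass w = m \<and> energy F w = min_energy TYPE('n) F m \<and> (\<forall>x. w x > 0) \<and> schwarz_symmetric R w"
proof -
  interpret schwarz_rearrangement R by (rule R)
  define E where "E = min_energy TYPE('n) F m"
  have "E < 0" using threshold_cases(2)[OF th m] by (simp add: E_def)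
  have "\<exists>v. schwarz_symmetric R v \<and> v \<in> lp 2 \<and> mass v = m \<and> energy F v \<le> E + 1 / Suc k" for k
  proof -
    have "\<not> E + 1 / Suc k \<le> min_energy TYPE('n) F m" by (simp add: E_def)
    hence "\<exists>u :: int ^ 'n \<Rightarrow> real. u \<in> lp 2 \<and> mass u = m \<and> \<not> E + 1 / Suc k \<le> energy F u"
      using min_energy_geI[of m "E + 1 / Suc k", where 'n = 'n] m(1) by force
    then obtain u :: "int ^ 'n \<Rightarrow> real" where u: "u \<in> lp 2" "mass u = m" "energy F u \<le> E + 1 / Suc k" by force
    from rearrangement[OF R mono abs u(1)] u(2,3) show ?thesis by force
  qed
  then obtain v where v: "\<And>k. schwarz_symmetric R (v k)" "\<And>k. v k \<in> lp 2" "\<And>k. mass (v k) = m"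
    "\<And>k. energy F (v k) \<le> E + 1 / Suc k" by metis
  obtain s w where s: "strict_mono s" and w4: "w \<in> lp 4"
    and conv: "(\<lambda>k. lp_norm 4 (\<lambda>x. v (s k) x - w x)) \<longlonglongrightarrow> 0"
    using compactness[of 2 4 v] v by (auto simp: lp_norm_2)
  have unif: "\<bar>v (s k) x - w x\<bar> \<le> lp_norm 4 (\<lambda>x. v (s k) x - w x)" for k x
    by (rule abs_le_lp4_norm[OF lp4_diff[OF lp2_imp_lp4[OF v(2)] w4]])
  have lim: "(\<lambda>k. v (s k) x) \<longlonglongrightarrow> w x" for x
  proof -
    have "(\<lambda>k. v (s k) x - w x) \<longlonglongrightarrow> 0" by (rule Lim_null_comparison[OF _ conv]) (use unif in simp)
    thus ?thesis by (rule LIM_zero_cancel)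
  qed
  have w0: "0 \<le> w x" for x
    by (rule LIMSEQ_le_const[OF lim]) (use v(1) in \<open>auto simp: schwarz_symmetric_def admissible_def\<close>)
  have w2: "(\<lambda>x. (w x)\<^sup>2) summable_on UNIV" "(\<Sum>\<^sub>\<infinity>x. (w x)\<^sup>2) \<le> m"
    using has_sum_fatou[OF lp2_has_sum[OF v(2)] _ tendsto_power[OF lim], where b = "\<lambda>_. m" and c = m] v(3)
    by auto
  hence w: "w \<in> lp 2" "mass w \<le> m" by (simp_all add: lp2_iff mass_def)
  have "(\<lambda>k. E + 1 / Suc (s k)) \<longlonglongrightarrow> E + 0"
    using LIMSEQ_subseq_LIMSEQ[OF lim_1_over_n[THEN LIMSEQ_Suc] s]
    by (intro tendsto_intros) (simp add: comp_def)
  hence Ew: "energy F w \<le> E"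
    using energy_lower_semicontinuous[OF F_nonneg[OF mono] v(2,3) m(1) w(1) w0 unif conv v(4)] by simp
  \<comment> \<open>The zero function is excluded as a limit: it has energy at least 0, but
    \<open>w\<close> has energy at most \<open>E < 0\<close>.\<close>
  have "mass w > 0"
  proof (rule ccontr)
    assume "\<not> mass w > 0"
    hence "w = (\<lambda>_. 0)" using mass_nonneg[of w] mass_eq_0_iff[OF w(1)] by linarith
    hence "(\<Sum>\<^sub>\<infinity>x. F (w x)) = 0" by (simp add: F_0)
    hence "0 \<le> energy F w" using dirichlet_nonneg[of w] by (simp add: energy_eq w(1))
    with Ew \<open>E < 0\<close> show False by simp
  qed
  define t where "t = sqrt (m / mass w)"
  have "t \<ge> 1" and t2: "t\<^sup>2 = m / mass w" using w(2) \<open>mass w > 0\<close> m(1) by (simp_all add: t_def)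
  have "(\<Sum>\<^sub>\<infinity>x. t\<^sup>2 * F (w x)) \<le> (\<Sum>\<^sub>\<infinity>x. F (t * w x))"
    using F_scale[OF mono w0 \<open>t \<ge> 1\<close>]
    by (intro infsum_mono summable_on_cmult_right F_summable w(1) lp2_cmult(1)) auto
  hence "energy F (\<lambda>x. t * w x) \<le> t\<^sup>2 * energy F w"
    unfolding energy_cmult[OF w(1)] energy_eq[OF w(1)] right_diff_distrib
    by (simp add: infsum_cmult_right F_summable w(1))
  also have "\<dots> \<le> t\<^sup>2 * E" by (intro mult_left_mono Ew) simp
  finally have "energy F (\<lambda>x. t * w x) \<le> t\<^sup>2 * E" .
  moreover have "E \<le> energy F (\<lambda>x. t * w x)"
    unfolding E_def using \<open>mass w > 0\<close> by (intro min_energy_le lp2_cmult(1) w(1)) (simp add: lp2_cmult(2)[OF w(1)] t2)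
  ultimately have "1 * E \<le> t\<^sup>2 * E" by simp
  hence "t\<^sup>2 \<le> 1" using \<open>E < 0\<close> by (simp only: mult_le_cancel_right)
  hence mw: "mass w = m" using t2 w(2) \<open>mass w > 0\<close> by (simp add: divide_le_eq)
  have "energy F w = E" using Ew min_energy_le[OF w(1) mw] by (simp add: E_def)
  hence min: "energy F w = min_energy TYPE('n) F m" by (simp add: E_def)
  have "schwarz_symmetric R w"
    by (rule pointwise_closed[of "\<lambda>k. v (s k)"]) (use v(1) lim admissible_lp2[OF w(1) w0] in auto)
  moreover have "0 < w x" for x by (rule minimiser_pos[OF w(1) w0 mw m(1) min])
  ultimately show ?thesis using w(1) mw min by blast
qed

end

section \<open>Primitives of continuous functions\<close>

text \<open>On bounded intervals \<open>\<bar>f t\<bar>\<close> is at most a multiple of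
  \<open>\<bar>t\<bar>\<close>, and the mean value inequality turns this into the Lipschitz bound.
  Near 0 the multiple can be made arbitrarily small, which gives \<open>F_small\<close>.\<close>

lemma potential_of_primitive:
  fixes f F :: "real \<Rightarrow> real"
  assumes cont: "continuous_on UNIV f" and small: "((\<lambda>t. f t / t) \<longlongrightarrow> 0) (at 0)"
    and F: "\<And>t. F t = (LBINT \<tau>=0..ereal t. f \<tau>)"
  shows "potential F"
proof -
  have F_eq: "F = (\<lambda>t. LBINT \<tau>=ereal 0..ereal t. f \<tau>)" by (rule ext) (simp add: F zero_ereal_def)
  have deriv: "(F has_real_derivative f t) (at t)" for t
  proof -
    \<comment> \<open>Puts \<open>t\<close> in the interior of the interval, so that the derivative
      within it is the full derivative.\<close>
    define r where "r = \<bar>t\<bar> + 1"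
    have "(F has_vector_derivative f t) (at t within {-r..r})"
      unfolding F_eq by (rule interval_integral_FTC2)
        (auto simp: r_def intro: continuous_on_subset[OF cont])
    moreover have "at t within {-r..r} = at t" by (rule at_within_Icc_at) (auto simp: r_def)
    ultimately show ?thesis by (simp add: has_real_derivative_iff_has_vector_derivative)
  qed
  have f0: "f 0 = 0"
  proof -
    have "((\<lambda>t. f t / t * t) \<longlongrightarrow> 0 * 0) (at 0)" by (intro tendsto_mult small tendsto_ident_at)
    moreover have "\<forall>\<^sub>F t in at 0. f t / t * t = f t" by (simp add: eventually_at_filter)
    ultimately have "(f \<longlongrightarrow> 0 * 0) (at 0)" by (rule Lim_transform_eventually)
    moreover have "(f \<longlongrightarrow> f 0) (at 0)"
      using cont by (simp add: continuous_on_def)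
    ultimately show ?thesis using tendsto_unique[of "at (0 :: real)"] by force
  qed
  have near: "\<exists>d>0. \<forall>t. \<bar>t\<bar> < d \<longrightarrow> \<bar>f t\<bar> \<le> \<eta> * \<bar>t\<bar>" if \<eta>: "\<eta> > 0" for \<eta>
  proof -
    obtain d where d: "d > 0" "\<And>t. t \<noteq> 0 \<Longrightarrow> \<bar>t\<bar> < d \<Longrightarrow> \<bar>f t / t\<bar> < \<eta>"
      using tendstoD[OF small \<eta>] by (auto simp: eventually_at dist_real_def)
    have "\<bar>f t\<bar> \<le> \<eta> * \<bar>t\<bar>" if "\<bar>t\<bar> < d" for t
      using d(2)[OF _ that] f0 by (cases "t = 0") (auto simp: field_simps)
    with d(1) show ?thesis by blast
  qed
  have linear: "\<exists>C\<ge>0. \<forall>t. \<bar>t\<bar> \<le> M \<longrightarrow> \<bar>f t\<bar> \<le> C * \<bar>t\<bar>" for M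
  proof -
    obtain d where d: "d > 0" "\<And>t. \<bar>t\<bar> < d \<Longrightarrow> \<bar>f t\<bar> \<le> 1 * \<bar>t\<bar>" using near[of 1] by auto
    have "bounded (f ` {-M..M})"
      by (intro compact_imp_bounded compact_continuous_image continuous_on_subset[OF cont]) auto
    then obtain b where b: "b > 0" "\<And>t. \<bar>t\<bar> \<le> M \<Longrightarrow> \<bar>f t\<bar> \<le> b"
      unfolding bounded_pos by (auto simp: abs_le_iff minus_le_iff)
    \<comment> \<open>The summand 1 covers the range near 0; from distance \<open>d\<close> on, the
      bound \<open>b\<close> on the compact interval is at most
      \<open>b / d * \<bar>t\<bar>\<close>.\<close>
    have "\<bar>f t\<bar> \<le> (1 + b / d) * \<bar>t\<bar>" if t: "\<bar>t\<bar> \<le> M" for t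
    proof (cases "\<bar>t\<bar> < d")
      case True
      have "0 \<le> b / d * \<bar>t\<bar>" using b(1) d(1) by simp
      thus ?thesis using d(2)[OF True] by (simp add: algebra_simps)
    next
      case False
      hence "b / d * d \<le> b / d * \<bar>t\<bar>" using b(1) d(1) by (intro mult_left_mono) auto
      hence "b \<le> b / d * \<bar>t\<bar>" using d(1) by simp
      thus ?thesis using b(2)[OF t] abs_ge_zero[of t] unfolding distrib_right mult_1 by linarith
    qed
    moreover have "0 \<le> 1 + b / d" using b(1) d(1) by simp
    ultimately show ?thesis by blast
  qed
  have mvt: "\<bar>F a - F b\<bar> \<le> C * ((\<bar>a\<bar> + \<bar>b\<bar>) * \<bar>a - b\<bar>)"
    if C: "C \<ge> 0" "\<And>t. \<bar>t\<bar> \<le> max \<bar>a\<bar> \<bar>b\<bar> \<Longrightarrow> \<bar>f t\<bar> \<le> C * \<bar>t\<bar>" for C a b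
  proof -
    let ?S = "{min a b..max a b}"
    have "norm (F a - F b) \<le> (C * (\<bar>a\<bar> + \<bar>b\<bar>)) * norm (a - b)"
    proof (rule field_differentiable_bound[where S = ?S and f' = f])
      fix z assume z: "z \<in> ?S"
      show "(F has_field_derivative f z) (at z within ?S)"
        by (rule has_field_derivative_at_within[OF deriv])
      have "\<bar>z\<bar> \<le> max \<bar>a\<bar> \<bar>b\<bar>" using z by (auto simp: min_def max_def abs_if split: if_splits)
      moreover from this have "C * \<bar>z\<bar> \<le> C * (\<bar>a\<bar> + \<bar>b\<bar>)" using C(1) by (intro mult_left_mono) auto
      ultimately show "norm (f z) \<le> C * (\<bar>a\<bar> + \<bar>b\<bar>)" using C(2)[of z] by simp
    qed auto
    thus ?thesis by simp
  qed
  show ?thesis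
  proof
    show "F 0 = 0" by (simp add: F_eq)
    show "\<exists>C\<ge>0. \<forall>a b. \<bar>a\<bar> \<le> M \<longrightarrow> \<bar>b\<bar> \<le> M \<longrightarrow> \<bar>F a - F b\<bar> \<le> C * ((\<bar>a\<bar> + \<bar>b\<bar>) * \<bar>a - b\<bar>)" for M
    proof -
      obtain C where C: "C \<ge> 0" "\<And>t. \<bar>t\<bar> \<le> M \<Longrightarrow> \<bar>f t\<bar> \<le> C * \<bar>t\<bar>" using linear by blast
      have "\<bar>F a - F b\<bar> \<le> C * ((\<bar>a\<bar> + \<bar>b\<bar>) * \<bar>a - b\<bar>)" if "\<bar>a\<bar> \<le> M" "\<bar>b\<bar> \<le> M" for a b
        by (rule mvt[OF C(1)]) (use C(2) that in auto)
      with C(1) show ?thesis by blast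
    qed
    show "\<exists>\<rho>>0. \<forall>t. \<bar>t\<bar> \<le> \<rho> \<longrightarrow> \<bar>F t\<bar> \<le> \<eta> * t\<^sup>2" if \<eta>: "\<eta> > 0" for \<eta>
    proof -
      obtain d where d: "d > 0" "\<And>t. \<bar>t\<bar> < d \<Longrightarrow> \<bar>f t\<bar> \<le> \<eta> * \<bar>t\<bar>" using near[OF \<eta>] by auto
      have "\<bar>F t\<bar> \<le> \<eta> * t\<^sup>2" if "\<bar>t\<bar> \<le> d / 2" for t
        using mvt[of \<eta> t 0] d \<open>\<eta> > 0\<close> that
        by (simp add: \<open>F 0 = 0\<close> power2_eq_square abs_mult[symmetric])
      with d(1) show ?thesis by (intro exI[of _ "d / 2"]) auto
    qed
  qed
qed

theorem theorem1p1:
  fixes f F :: "real \<Rightarrow> real"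
  assumes "CARD('n::finite) \<ge> 2"
    and "continuous_on UNIV f"
    and "((\<lambda>t. f t / t) \<longlongrightarrow> 0) (at 0)"
    and "\<And>t. F t = (LBINT \<tau>=0..ereal t. f \<tau>)"
  shows "(\<forall>m>0. ground_energy TYPE('n) F m > -\<infinity>)
    \<and> antimono_on {0<..} (ground_energy TYPE('n) F)
    \<and> continuous_on {0<..} (ground_energy TYPE('n) F)
    \<and> (\<exists>!ms. is_threshold TYPE('n) F ms)
    \<and> (\<forall>ms. is_threshold TYPE('n) F ms \<longrightarrow>
        (antimono_on {..<0} (\<lambda>t. F t / t\<^sup>2) \<and> mono_on {0<..} (\<lambda>t. F t / t\<^sup>2) \<and> (\<forall>t. F t \<le> F \<bar>t\<bar>) \<longrightarrow>
          (\<forall>R :: (int ^ 'n \<Rightarrow> real) \<Rightarrow> int ^ 'n \<Rightarrow> real. schwarz_rearrangement R \<longrightarrow>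
            (\<forall>m>0. ms < ereal m \<longrightarrow>
              (\<exists>u \<in> mass_sphere m. ereal (energy F u) = ground_energy TYPE('n) F m
                 \<and> (\<forall>x. u x > 0) \<and> schwarz_symmetric R u))))
      \<and> (\<forall>\<zeta>>0. F \<zeta> - 2 * real CARD('n) * \<zeta>\<^sup>2 > 0 \<longrightarrow> 0 \<le> ms \<and> ms < ereal (\<zeta>\<^sup>2))
      \<and> (Limsup (at 0) (\<lambda>t. ereal (F t / \<bar>t\<bar> powr (2 + 4 / real CARD('n)))) < \<infinity> \<longrightarrow> 0 < ms)
      \<and> (strict_antimono_on {..<0} (\<lambda>t. F t / t\<^sup>2) \<and> strict_mono_on {0<..} (\<lambda>t. F t / t\<^sup>2) \<longrightarrow>
          (\<forall>m>0. ereal m < ms \<longrightarrow>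
            \<not> (\<exists>u \<in> (mass_sphere m :: (int ^ 'n \<Rightarrow> real) set).
                  ereal (energy F u) = ground_energy TYPE('n) F m))))"
proof -
  interpret potential F by (rule potential_of_primitive[OF assms(2-4)])
  note E_eq = ground_energy_eq[where 'n = 'n]
  have "continuous_on {0<..} (\<lambda>m. ereal (min_energy TYPE('n) F m))"
    by (intro continuous_on_ereal min_energy_continuous)
  hence "continuous_on {0<..} (ground_energy TYPE('n) F)"
    by (rule continuous_on_cong[THEN iffD1, rotated 2]) (simp_all add: E_eq)
  moreover have "antimono_on {0<..} (ground_energy TYPE('n) F)"
    by (rule monotone_onI) (simp add: E_eq min_energy_antimono)
  moreover have "\<exists>u \<in> mass_sphere m. ereal (energy F u) = ground_energy TYPE('n) F m
      \<and> (\<forall>x. u x > 0) \<and> schwarz_symmetric R u"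
    if "is_threshold TYPE('n) F ms" "mono_on {0<..} (\<lambda>t. F t / t\<^sup>2)" "\<forall>t. F t \<le> F \<bar>t\<bar>"
      "schwarz_rearrangement R" "m > 0" "ms < ereal m"
    for ms m and R :: "(int ^ 'n \<Rightarrow> real) \<Rightarrow> int ^ 'n \<Rightarrow> real"
    using symmetric_minimiser_exists[OF that(1,4,2) _ that(5,6)] that(3,5)
    by (auto simp: mass_sphere_iff E_eq)
  moreover have "\<not> (\<exists>u \<in> (mass_sphere m :: (int ^ 'n \<Rightarrow> real) set).
      ereal (energy F u) = ground_energy TYPE('n) F m)"
    if "is_threshold TYPE('n) F ms" "strict_antimono_on {..<0} (\<lambda>t. F t / t\<^sup>2)"
      "strict_mono_on {0<..} (\<lambda>t. F t / t\<^sup>2)" "m > 0" "ereal m < ms" for ms m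
    using min_energy_not_attained[OF that] that(4) by (auto simp: mass_sphere_iff E_eq)
  moreover have "0 \<le> ms" if "is_threshold TYPE('n) F ms" for ms
    using that by (simp add: is_threshold_def)
  ultimately show ?thesis
    using threshold_exists[where 'n = 'n] threshold_less[where 'n = 'n] threshold_pos[where 'n = 'n]
    by (auto simp: E_eq)
qed

end
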